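(* Let $M$ be a submanifold of Euclidean $m$-space $\mathbb{E}^m$ with position vector field $\mathbf{x}=\mathbf{x}^T+\mathbf{x}^N$, where $\mathbf{x}^T$ and $\mathbf{x}^N$ are the tangential and normal components of $\mathbf{x}$. If $\mathbf{x}^N\neq 0$, then $M$ is a proper rectifying submanifold if and only if $\mathbf{x}^T$ is a concurrent vector field on $M$.
   Context: A submanifold of $\mathbb{E}^m$ means a Riemannian manifold $M$ with an isometric immersion $x:M\to\mathbb{E}^m$. The position vector field $\mathbf{x}$ assigns to $p\in M$ the vector $x(p)$, regarded as an element of $T_p\mathbb{E}^m=T_pM\oplus T_p^\perp M$. Let $h$ be the second fundamental form of $M$ in $\mathbb{E}^m$. The first normal space at $p$ is $\mathrm{Im}\,h_p=\mathrm{Span}\{h(X,Y): X,Y\in T_pM\}$. $M$ is a rectifying submanifold if $\langle \mathbf{x}(p),\mathrm{Im}\,h_p\rangle=0$ for every $p\in M$. A rectifying submanifold is proper if $\mathbf{x}\neq\mathbf{x}^T$ and $\mathbf{x}\neq\mathbf{x}^N$ at every point of $M$. A non-trivial vector field $Z$ on a Riemannian manifold $M$ with Levi-Civita connection $\nabla$ is called a concurrent vector field if $\nabla_XZ=X$ for any vector $X$ tangent to $M$.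
   Formalization: "Non-trivial" in "concurrent vector field" is taken to mean nowhere zero (and x^N≠0 holds at every point); with "not identically zero" the claim fails for the plane z=1 in E^3, where x^T=(u,v,0) is concurrent but x=x^N at (0,0,1). *)

theory Defs
  imports "HOL-Analysis.Analysis"
begin

section \<open>Smooth maps between open subsets of Euclidean spaces\<close>

text \<open>The predicates below are only meaningful on open sets, and are only used there.\<close>

primrec times_differentiable_on ::
  "nat \<Rightarrow> 'e::real_normed_vector set \<Rightarrow> ('e \<Rightarrow> 'b::real_normed_vector) \<Rightarrow> bool" where
  "times_differentiable_on 0 S f \<longleftrightarrow> continuous_on S f"
| "times_differentiable_on (Suc k) S f \<longleftrightarrow>
     (\<forall>u\<in>S. f differentiable (at u)) \<and>
     (\<forall>w. times_differentiable_on k S (\<lambda>u. frechet_derivative f (at u) w))"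

definition smooth_on :: "'e::real_normed_vector set \<Rightarrow> ('e \<Rightarrow> 'b::real_normed_vector) \<Rightarrow> bool" where
  "smooth_on S f \<longleftrightarrow> (\<forall>k. times_differentiable_on k S f)"

section \<open>Smooth manifolds\<close>

text \<open>A chart is its domain together with its coordinate map. The values of the
  coordinate map outside the domain are irrelevant.\<close>

type_synonym ('a, 'e) chart = "'a set \<times> ('a \<Rightarrow> 'e)"

definition coord_rep :: "('a, 'e) chart \<Rightarrow> ('a \<Rightarrow> 'b) \<Rightarrow> 'e \<Rightarrow> 'b" where
  "coord_rep c f = f \<circ> inv_into (fst c) (snd c)"

definition charts_at :: "('a, 'e) chart set \<Rightarrow> 'a \<Rightarrow> ('a, 'e) chart set" where
  "charts_at A p = {c \<in> A. p \<in> fst c}"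

text \<open>The atlas is not required to be maximal; the dimension of the manifold is \<open>DIM('e)\<close>.\<close>

definition smooth_manifold :: "'a topology \<Rightarrow> ('a, 'e::euclidean_space) chart set \<Rightarrow> bool" where
  "smooth_manifold M A \<longleftrightarrow>
     Hausdorff_space M \<and> second_countable M \<and>
     topspace M = (\<Union>c\<in>A. fst c) \<and>
     (\<forall>c\<in>A. openin M (fst c) \<and> open (snd c ` fst c) \<and>
        homeomorphic_map (subtopology M (fst c)) (top_of_set (snd c ` fst c)) (snd c)) \<and>
     (\<forall>c\<in>A. \<forall>d\<in>A. smooth_on (snd c ` (fst c \<inter> fst d)) (coord_rep c (snd d)))"

definition smooth_map :: "('a, 'e::euclidean_space) chart set \<Rightarrow> ('a \<Rightarrow> 'b::real_normed_vector) \<Rightarrow> bool" where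
  "smooth_map A f \<longleftrightarrow> (\<forall>c\<in>A. smooth_on (snd c ` fst c) (coord_rep c f))"

section \<open>Tangent vectors and vector fields\<close>

text \<open>A tangent vector at \<open>p\<close> is the family of its components in the charts around \<open>p\<close>,
  subject to the transformation law; for all other charts the component is set to \<open>0\<close>, so that
  equality of tangent vectors is equality of functions. Sums and multiples are taken
  componentwise, and the zero vector is \<open>\<lambda>_. 0\<close>.\<close>

type_synonym ('a, 'e) tangent = "('a, 'e) chart \<Rightarrow> 'e"
type_synonym ('a, 'e) field = "'a \<Rightarrow> ('a, 'e) tangent"

definition tangent_space :: "('a, 'e::euclidean_space) chart set \<Rightarrow> 'a \<Rightarrow> ('a, 'e) tangent set" where
  "tangent_space A p = {v.
     (\<forall>c\<in>charts_at A p. \<forall>d\<in>charts_at A p.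
        v d = frechet_derivative (coord_rep c (snd d)) (at (snd c p)) (v c)) \<and>
     (\<forall>c. c \<notin> charts_at A p \<longrightarrow> v c = 0)}"

text \<open>By the transformation law and the chain rule, the choice of chart is immaterial
  for tangent vectors \<open>v\<close> at \<open>p\<close>.\<close>

definition differential ::
  "('a, 'e::euclidean_space) chart set \<Rightarrow> ('a \<Rightarrow> 'b::real_normed_vector) \<Rightarrow> 'a \<Rightarrow> ('a, 'e) tangent \<Rightarrow> 'b" where
  "differential A f p v =
     (let c = (SOME c. c \<in> charts_at A p)
      in frechet_derivative (coord_rep c f) (at (snd c p)) (v c))"

definition smooth_vector_field ::
  "'a topology \<Rightarrow> ('a, 'e::euclidean_space) chart set \<Rightarrow> ('a, 'e) field \<Rightarrow> bool" where
  "smooth_vector_field M A Z \<longleftrightarrow>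
     (\<forall>p\<in>topspace M. Z p \<in> tangent_space A p) \<and>
     (\<forall>c\<in>A. smooth_on (snd c ` fst c) (coord_rep c (\<lambda>p. Z p c)))"

text \<open>In coordinates, \<open>[X, Y]\<^sup>k = X\<^sup>i \<partial>\<^sub>i Y\<^sup>k - Y\<^sup>i \<partial>\<^sub>i X\<^sup>k\<close>.\<close>

definition lie_bracket ::
  "('a, 'e::euclidean_space) chart set \<Rightarrow> ('a, 'e) field \<Rightarrow> ('a, 'e) field \<Rightarrow> ('a, 'e) field" where
  "lie_bracket A X Y p = (\<lambda>c.
     if c \<in> charts_at A p then
       frechet_derivative (coord_rep c (\<lambda>q. Y q c)) (at (snd c p)) (X p c) -
       frechet_derivative (coord_rep c (\<lambda>q. X q c)) (at (snd c p)) (Y p c)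
     else 0)"

section \<open>Riemannian metrics and the Levi-Civita connection\<close>

type_synonym ('a, 'e) metric = "'a \<Rightarrow> ('a, 'e) tangent \<Rightarrow> ('a, 'e) tangent \<Rightarrow> real"

definition riemannian_manifold ::
  "'a topology \<Rightarrow> ('a, 'e::euclidean_space) chart set \<Rightarrow> ('a, 'e) metric \<Rightarrow> bool" where
  "riemannian_manifold M A g \<longleftrightarrow>
     smooth_manifold M A \<and>
     (\<forall>p\<in>topspace M. \<forall>u\<in>tangent_space A p. \<forall>v\<in>tangent_space A p.
        g p u v = g p v u \<and>
        (\<forall>w\<in>tangent_space A p. g p (\<lambda>c. u c + v c) w = g p u w + g p v w) \<and>
        (\<forall>r::real. g p (\<lambda>c. r *\<^sub>R u c) v = r * g p u v) \<and>
        (u \<noteq> (\<lambda>_. 0) \<longrightarrow> g p u u > 0)) \<and>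
     (\<forall>X Y. smooth_vector_field M A X \<longrightarrow> smooth_vector_field M A Y \<longrightarrow>
        smooth_map A (\<lambda>p. g p (X p) (Y p)))"

text \<open>\<open>nabla p u Y\<close> is the covariant derivative of the vector field \<open>Y\<close> in the direction of
  the tangent vector \<open>u\<close> at \<open>p\<close>.\<close>

type_synonym ('a, 'e) connection =
  "'a \<Rightarrow> ('a, 'e) tangent \<Rightarrow> ('a, 'e) field \<Rightarrow> ('a, 'e) tangent"

definition affine_connection ::
  "'a topology \<Rightarrow> ('a, 'e::euclidean_space) chart set \<Rightarrow> ('a, 'e) connection \<Rightarrow> bool" where
  "affine_connection M A nabla \<longleftrightarrow>
     (\<forall>Y. smooth_vector_field M A Y \<longrightarrow>
        (\<forall>X. smooth_vector_field M A X \<longrightarrow> smooth_vector_field M A (\<lambda>p. nabla p (X p) Y)) \<and>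
        (\<forall>p\<in>topspace M. \<forall>u\<in>tangent_space A p.
           nabla p u Y \<in> tangent_space A p \<and>
           (\<forall>v\<in>tangent_space A p.
              nabla p (\<lambda>c. u c + v c) Y = (\<lambda>c. nabla p u Y c + nabla p v Y c)) \<and>
           (\<forall>r::real. nabla p (\<lambda>c. r *\<^sub>R u c) Y = (\<lambda>c. r *\<^sub>R nabla p u Y c)) \<and>
           (\<forall>Z. smooth_vector_field M A Z \<longrightarrow>
              nabla p u (\<lambda>q c. Y q c + Z q c) = (\<lambda>c. nabla p u Y c + nabla p u Z c)) \<and>
           (\<forall>f::'a \<Rightarrow> real. smooth_map A f \<longrightarrow>
              nabla p u (\<lambda>q c. f q *\<^sub>R Y q c) =
                (\<lambda>c. differential A f p u *\<^sub>R Y p c + f p *\<^sub>R nabla p u Y c))))"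

definition levi_civita_connection ::
  "'a topology \<Rightarrow> ('a, 'e::euclidean_space) chart set \<Rightarrow> ('a, 'e) metric \<Rightarrow> ('a, 'e) connection \<Rightarrow> bool" where
  "levi_civita_connection M A g nabla \<longleftrightarrow>
     affine_connection M A nabla \<and>
     (\<forall>X Y. smooth_vector_field M A X \<longrightarrow> smooth_vector_field M A Y \<longrightarrow>
        (\<forall>p\<in>topspace M.
           (\<lambda>c. nabla p (X p) Y c - nabla p (Y p) X c) = lie_bracket A X Y p \<and>
           (\<forall>u\<in>tangent_space A p.
              differential A (\<lambda>q. g q (X q) (Y q)) p u =
                g p (nabla p u X) (Y p) + g p (X p) (nabla p u Y))))"

text \<open>Here ``non-trivial'' means non-zero at every point, in the same way as the conditions
  \<open>\<noteq>\<close> between position vector fields below are conditions at every point. Under the weaker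
  reading ``not identically zero'', the tangential part of the position vector field of the
  plane \<open>z = 1\<close> in \<open>\<real>\<^sup>3\<close> would be concurrent although it vanishes at the point \<open>(0, 0, 1)\<close>.\<close>

definition concurrent_vector_field ::
  "'a topology \<Rightarrow> ('a, 'e::euclidean_space) chart set \<Rightarrow> ('a, 'e) connection \<Rightarrow> ('a, 'e) field \<Rightarrow> bool" where
  "concurrent_vector_field M A nabla Z \<longleftrightarrow>
     smooth_vector_field M A Z \<and>
     (\<forall>p\<in>topspace M. Z p \<noteq> (\<lambda>_. 0)) \<and>
     (\<forall>p\<in>topspace M. \<forall>u\<in>tangent_space A p. nabla p u Z = u)"

section \<open>Submanifolds of Euclidean space\<close>

definition euclidean_submanifold ::
  "'a topology \<Rightarrow> ('a, 'e::euclidean_space) chart set \<Rightarrow> ('a, 'e) metric \<Rightarrow>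
   ('a \<Rightarrow> 'b::euclidean_space) \<Rightarrow> bool" where
  "euclidean_submanifold M A g x \<longleftrightarrow>
     riemannian_manifold M A g \<and>
     smooth_map A x \<and>
     (\<forall>p\<in>topspace M.
        inj_on (differential A x p) (tangent_space A p) \<and>
        (\<forall>u\<in>tangent_space A p. \<forall>v\<in>tangent_space A p.
           g p u v = differential A x p u \<bullet> differential A x p v))"

definition tangent_plane ::
  "('a, 'e::euclidean_space) chart set \<Rightarrow> ('a \<Rightarrow> 'b::euclidean_space) \<Rightarrow> 'a \<Rightarrow> 'b set" where
  "tangent_plane A x p = differential A x p ` tangent_space A p"

definition tangential_part ::
  "('a, 'e::euclidean_space) chart set \<Rightarrow> ('a \<Rightarrow> 'b::euclidean_space) \<Rightarrow> 'a \<Rightarrow> 'b \<Rightarrow> 'b" where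
  "tangential_part A x p w =
     (THE t. t \<in> tangent_plane A x p \<and> (\<forall>s\<in>tangent_plane A x p. (w - t) \<bullet> s = 0))"

definition normal_part ::
  "('a, 'e::euclidean_space) chart set \<Rightarrow> ('a \<Rightarrow> 'b::euclidean_space) \<Rightarrow> 'a \<Rightarrow> 'b \<Rightarrow> 'b" where
  "normal_part A x p w = w - tangential_part A x p w"

text \<open>\<open>h(u, v)\<close> is the normal part of the flat derivative, in the direction of \<open>u\<close>, of any smooth
  tangent vector field \<open>Y\<close> with \<open>Y p = v\<close>, regarded as a map into the ambient space. Such a \<open>Y\<close>
  always exists (project a constant ambient vector to the tangent planes), and the value does not
  depend on it.\<close>

definition second_fundamental_form ::
  "'a topology \<Rightarrow> ('a, 'e::euclidean_space) chart set \<Rightarrow> ('a \<Rightarrow> 'b::euclidean_space) \<Rightarrow>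
   'a \<Rightarrow> ('a, 'e) tangent \<Rightarrow> ('a, 'e) tangent \<Rightarrow> 'b" where
  "second_fundamental_form M A x p u v =
     (THE w. \<forall>Y. smooth_vector_field M A Y \<and> Y p = v \<longrightarrow>
        w = normal_part A x p (differential A (\<lambda>q. differential A x q (Y q)) p u))"

definition first_normal_space ::
  "'a topology \<Rightarrow> ('a, 'e::euclidean_space) chart set \<Rightarrow> ('a \<Rightarrow> 'b::euclidean_space) \<Rightarrow> 'a \<Rightarrow> 'b set" where
  "first_normal_space M A x p =
     span {second_fundamental_form M A x p u v | u v. u \<in> tangent_space A p \<and> v \<in> tangent_space A p}"

definition rectifying ::
  "'a topology \<Rightarrow> ('a, 'e::euclidean_space) chart set \<Rightarrow> ('a \<Rightarrow> 'b::euclidean_space) \<Rightarrow> bool" where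
  "rectifying M A x \<longleftrightarrow> (\<forall>p\<in>topspace M. \<forall>w\<in>first_normal_space M A x p. x p \<bullet> w = 0)"

definition proper_rectifying ::
  "'a topology \<Rightarrow> ('a, 'e::euclidean_space) chart set \<Rightarrow> ('a \<Rightarrow> 'b::euclidean_space) \<Rightarrow> bool" where
  "proper_rectifying M A x \<longleftrightarrow>
     rectifying M A x \<and>
     (\<forall>p\<in>topspace M. x p \<noteq> tangential_part A x p (x p) \<and> x p \<noteq> normal_part A x p (x p))"

text \<open>The tangential part of the position vector field, as a vector field on \<open>M\<close>: the tangent
  vector that the differential of the immersion maps to it.\<close>

definition tangential_position_field ::
  "('a, 'e::euclidean_space) chart set \<Rightarrow> ('a \<Rightarrow> 'b::euclidean_space) \<Rightarrow> ('a, 'e) field" where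
  "tangential_position_field A x p =
     inv_into (tangent_space A p) (differential A x p) (tangential_part A x p (x p))"

end

theory Submission
  imports Defs
begin

text \<open>Tangent fields on a submanifold are identified with maps into the ambient space. Gauss'
  formula says that the Levi-Civita derivative is the tangential part of the flat derivative
  \<open>D\<close>, so \<open>\<nabla>\<^sub>u x\<^sup>T\<close> is the tangential part of \<open>D\<^sub>u x - D\<^sub>u x\<^sup>N = u - D\<^sub>u x\<^sup>N\<close>.
  Differentiating \<open>\<langle>x\<^sup>N, Y\<rangle> = 0\<close> for a tangent field \<open>Y\<close> gives
  \<open>\<langle>D\<^sub>u x\<^sup>N, Y\<rangle> = - \<langle>x\<^sup>N, D\<^sub>u Y\<rangle> = - \<langle>x, h(u, Y)\<rangle>\<close>. Hence \<open>\<nabla>\<^sub>u x\<^sup>T = u\<close> for all \<open>u\<close> if and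
  only if \<open>x\<close> is orthogonal to the first normal space. The remaining conditions match because
  \<open>x\<^sup>T\<close> vanishes exactly where \<open>x = x\<^sup>N\<close>.\<close>

section \<open>Smooth maps\<close>

text \<open>On an open set, agreement on \<open>S\<close> is agreement near each of its points, so
  the derivatives agree on \<open>S\<close> as well and the induction continues with them.\<close>

lemma times_differentiable_on_cong:
  assumes "open S" "times_differentiable_on k S f" "\<And>u. u \<in> S \<Longrightarrow> f u = g u"
  shows "times_differentiable_on k S g"
  using assms
proof (induction k arbitrary: f g)
  case 0
  then show ?case by (simp cong: continuous_on_cong)
next
  case (Suc k)
  have d: "g differentiable (at u)" if "u \<in> S" for u
    using Suc.prems that unfolding differentiable_def times_differentiable_on.simps
    by (metis has_derivative_transform_within_open)
  have e: "frechet_derivative f (at u) = frechet_derivative g (at u)" if "u \<in> S" for u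
    using frechet_derivative_transform_within_open[of f u S g] Suc.prems that by auto
  show ?case
    using d e Suc.prems Suc.IH[of "\<lambda>u. frechet_derivative f (at u) w"
        "\<lambda>u. frechet_derivative g (at u) w" for w]
    by simp
qed

text \<open>Product rules leave undifferentiated factors behind, which must be available at the
  lower order. The base case is that differentiability gives continuity.\<close>

lemma times_differentiable_on_Suc_imp:
  "times_differentiable_on (Suc k) S f \<Longrightarrow> times_differentiable_on k S f"
proof (induction k arbitrary: f)
  case 0
  then show ?case
    by (auto simp: continuous_on_eq_continuous_at intro!: differentiable_imp_continuous_within
        continuous_at_imp_continuous_on)
next
  case (Suc k)
  then show ?case by (metis times_differentiable_on.simps(2))
qed

lemma times_differentiable_on_const: "times_differentiable_on k S (\<lambda>_. a)"
  by (induction k arbitrary: a) auto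

lemma times_differentiable_on_linear:
  assumes "bounded_linear L" "open S"
  shows "times_differentiable_on k S f \<Longrightarrow> times_differentiable_on k S (\<lambda>u. L (f u))"
proof (induction k arbitrary: f)
  case 0
  then show ?case using assms by (auto intro: bounded_linear.continuous_on)
next
  case (Suc k)
  have d: "((\<lambda>u. L (f u)) has_derivative (\<lambda>w. L (frechet_derivative f (at u) w))) (at u)"
    if "u \<in> S" for u
    using bounded_linear.has_derivative[OF assms(1)] Suc.prems that
    by (auto simp: frechet_derivative_works)
  have e: "frechet_derivative (\<lambda>u. L (f u)) (at u) w = L (frechet_derivative f (at u) w)"
    if "u \<in> S" for u w
    using frechet_derivative_at[OF d[OF that]] by metis
  \<comment> \<open>The formula \<open>e\<close> for the derivative is known on \<open>S\<close>
    only, hence the passage through the congruence lemma. The sum, product and reciprocal cases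
    follow the same pattern.\<close>
  have "times_differentiable_on k S (\<lambda>u. frechet_derivative (\<lambda>u. L (f u)) (at u) w)" for w
    by (rule times_differentiable_on_cong[OF assms(2) Suc.IH]) (use Suc.prems e in auto)
  then show ?case using d by (auto simp: differentiable_def)
qed

lemma times_differentiable_on_add:
  assumes "open S"
  shows "times_differentiable_on k S f \<Longrightarrow> times_differentiable_on k S g \<Longrightarrow>
    times_differentiable_on k S (\<lambda>u. f u + g u)"
proof (induction k arbitrary: f g)
  case 0
  then show ?case by (auto intro: continuous_intros)
next
  case (Suc k)
  have d: "((\<lambda>u. f u + g u) has_derivative
      (\<lambda>w. frechet_derivative f (at u) w + frechet_derivative g (at u) w)) (at u)"
    if "u \<in> S" for u
    using Suc.prems that by (auto simp: frechet_derivative_works intro: has_derivative_add)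
  have e: "frechet_derivative (\<lambda>u. f u + g u) (at u) w =
      frechet_derivative f (at u) w + frechet_derivative g (at u) w"
    if "u \<in> S" for u w
    using frechet_derivative_at[OF d[OF that]] by metis
  have "times_differentiable_on k S (\<lambda>u. frechet_derivative (\<lambda>u. f u + g u) (at u) w)" for w
    by (rule times_differentiable_on_cong[OF assms Suc.IH[of "\<lambda>u. frechet_derivative f (at u) w"
            "\<lambda>u. frechet_derivative g (at u) w"]])
      (use Suc.prems e in auto)
  then show ?case using d by (auto simp: differentiable_def)
qed

lemma times_differentiable_on_bilinear:
  assumes B: "bounded_bilinear B" and "open S"
  shows "times_differentiable_on k S f \<Longrightarrow> times_differentiable_on k S g \<Longrightarrow>
    times_differentiable_on k S (\<lambda>u. B (f u) (g u))"
proof (induction k arbitrary: f g)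
  case 0
  then show ?case using B by (auto intro: bounded_bilinear.continuous_on)
next
  case (Suc k)
  have d: "((\<lambda>u. B (f u) (g u)) has_derivative
      (\<lambda>w. B (f u) (frechet_derivative g (at u) w) + B (frechet_derivative f (at u) w) (g u))) (at u)"
    if "u \<in> S" for u
    using Suc.prems that
    by (auto simp: frechet_derivative_works intro: bounded_bilinear.FDERIV[OF B])
  have e: "frechet_derivative (\<lambda>u. B (f u) (g u)) (at u) w =
      B (f u) (frechet_derivative g (at u) w) + B (frechet_derivative f (at u) w) (g u)"
    if "u \<in> S" for u w
    using frechet_derivative_at[OF d[OF that]] by metis
  have t: "times_differentiable_on k S f" "times_differentiable_on k S g"
    using Suc.prems times_differentiable_on_Suc_imp by blast+
  have "times_differentiable_on k S (\<lambda>u. frechet_derivative (\<lambda>u. B (f u) (g u)) (at u) w)" for w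
  proof (rule times_differentiable_on_cong[OF \<open>open S\<close>
        times_differentiable_on_add[OF \<open>open S\<close> Suc.IH[OF t(1)] Suc.IH[OF _ t(2)]]])
    show "times_differentiable_on k S (\<lambda>u. frechet_derivative g (at u) w)"
      "times_differentiable_on k S (\<lambda>u. frechet_derivative f (at u) w)"
      using Suc.prems by auto
  qed (simp add: e)
  then show ?case using d by (auto simp: differentiable_def)
qed

text \<open>The derivative of \<open>1/f\<close> is a product of two copies of \<open>1/f\<close>,
  which the induction hypothesis controls at order \<open>k\<close>, and the derivative of
  \<open>f\<close>.\<close>

lemma times_differentiable_on_inverse:
  fixes f :: "'e::real_normed_vector \<Rightarrow> real"
  assumes "open S" and nz: "\<And>u. u \<in> S \<Longrightarrow> f u \<noteq> 0"
  shows "times_differentiable_on k S f \<Longrightarrow> times_differentiable_on k S (\<lambda>u. inverse (f u))"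
proof (induction k)
  case 0
  then show ?case using nz by (auto intro: continuous_intros)
next
  case (Suc k)
  have d: "((\<lambda>u. inverse (f u)) has_derivative
      (\<lambda>w. - (inverse (f u) * frechet_derivative f (at u) w * inverse (f u)))) (at u)"
    if "u \<in> S" for u
    using Suc.prems that nz
    by (auto simp: frechet_derivative_works intro: has_derivative_inverse)
  have e: "frechet_derivative (\<lambda>u. inverse (f u)) (at u) w =
      - (inverse (f u) * frechet_derivative f (at u) w * inverse (f u))"
    if "u \<in> S" for u w
    using frechet_derivative_at[OF d[OF that]] by metis
  have t: "times_differentiable_on k S (\<lambda>u. inverse (f u))"
    using Suc times_differentiable_on_Suc_imp by blast
  have "times_differentiable_on k S (\<lambda>u. frechet_derivative (\<lambda>u. inverse (f u)) (at u) w)" for w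
  proof (rule times_differentiable_on_cong[OF \<open>open S\<close>
        times_differentiable_on_linear[OF bounded_linear_minus[OF bounded_linear_ident] \<open>open S\<close>
          times_differentiable_on_bilinear[OF bounded_bilinear_mult \<open>open S\<close>
            times_differentiable_on_bilinear[OF bounded_bilinear_mult \<open>open S\<close> t] t]]])
    show "times_differentiable_on k S (\<lambda>u. frechet_derivative f (at u) w)"
      using Suc.prems by auto
  qed (simp add: e)
  then show ?case using d by (auto simp: differentiable_def)
qed

section \<open>Closure properties of smooth maps\<close>

lemma smooth_on_cong:
  "open S \<Longrightarrow> smooth_on S f \<Longrightarrow> (\<And>u. u \<in> S \<Longrightarrow> f u = g u) \<Longrightarrow> smooth_on S g"
  unfolding smooth_on_def using times_differentiable_on_cong by blast

lemma smooth_on_const: "smooth_on S (\<lambda>_. a)"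
  by (simp add: smooth_on_def times_differentiable_on_const)

lemma smooth_on_linear: "bounded_linear L \<Longrightarrow> open S \<Longrightarrow> smooth_on S f \<Longrightarrow> smooth_on S (\<lambda>u. L (f u))"
  unfolding smooth_on_def using times_differentiable_on_linear by blast

lemma smooth_on_add:
  "open S \<Longrightarrow> smooth_on S f \<Longrightarrow> smooth_on S g \<Longrightarrow> smooth_on S (\<lambda>u. f u + g u)"
  unfolding smooth_on_def using times_differentiable_on_add by blast

lemma smooth_on_bilinear:
  "bounded_bilinear B \<Longrightarrow> open S \<Longrightarrow> smooth_on S f \<Longrightarrow> smooth_on S g \<Longrightarrow>
    smooth_on S (\<lambda>u. B (f u) (g u))"
  unfolding smooth_on_def using times_differentiable_on_bilinear by blast

lemmas smooth_on_mult = smooth_on_bilinear[OF bounded_bilinear_mult]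
lemmas smooth_on_inner = smooth_on_bilinear[OF bounded_bilinear_inner]
lemmas smooth_on_scaleR = smooth_on_bilinear[OF bounded_bilinear_scaleR]

lemma smooth_on_divide:
  fixes f g :: "'e::real_normed_vector \<Rightarrow> real"
  assumes "open S" "smooth_on S f" "smooth_on S g" "\<And>u. u \<in> S \<Longrightarrow> g u \<noteq> 0"
  shows "smooth_on S (\<lambda>u. f u / g u)"
proof -
  have "smooth_on S (\<lambda>u. inverse (g u))"
    using assms times_differentiable_on_inverse unfolding smooth_on_def by blast
  then show ?thesis
    unfolding divide_inverse by (rule smooth_on_mult[OF assms(1,2)])
qed

lemma smooth_on_sum:
  "finite I \<Longrightarrow> open S \<Longrightarrow> (\<And>i. i \<in> I \<Longrightarrow> smooth_on S (f i)) \<Longrightarrow> smooth_on S (\<lambda>u. \<Sum>i\<in>I. f i u)"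
  by (induction I rule: finite_induct) (auto intro: smooth_on_const smooth_on_add)

lemma smooth_on_prod:
  fixes f :: "'i \<Rightarrow> 'e::real_normed_vector \<Rightarrow> real"
  shows "finite I \<Longrightarrow> open S \<Longrightarrow> (\<And>i. i \<in> I \<Longrightarrow> smooth_on S (f i)) \<Longrightarrow> smooth_on S (\<lambda>u. \<Prod>i\<in>I. f i u)"
  by (induction I rule: finite_induct) (auto intro: smooth_on_const smooth_on_mult)

section \<open>Smooth solutions of linear systems\<close>

lemma smooth_on_vec:
  fixes f :: "'e::real_normed_vector \<Rightarrow> real ^ 'n"
  assumes "open S" "\<And>i. smooth_on S (\<lambda>u. f u $ i)"
  shows "smooth_on S f"
proof -
  have "smooth_on S (\<lambda>u. \<Sum>i\<in>UNIV. (f u $ i) *\<^sub>R axis i 1)"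
    by (intro smooth_on_sum smooth_on_scaleR assms smooth_on_const) auto
  then show ?thesis
    by (rule smooth_on_cong[OF assms(1)])
      (simp add: basis_expansion scalar_mult_eq_scaleR[symmetric])
qed

lemma smooth_on_det:
  fixes a :: "'e::real_normed_vector \<Rightarrow> real ^ 'n ^ 'n"
  assumes "open S" "\<And>i j. smooth_on S (\<lambda>u. a u $ i $ j)"
  shows "smooth_on S (\<lambda>u. det (a u))"
  unfolding det_def
  by (intro smooth_on_sum smooth_on_mult smooth_on_prod smooth_on_const assms) (auto simp: assms)

text \<open>By Cramer's rule each component of \<open>z\<close> is a quotient of two determinants,
  which are polynomials in the smooth entries of \<open>a\<close> and \<open>b\<close>.\<close>

lemma smooth_on_solution:
  fixes a :: "'e::real_normed_vector \<Rightarrow> real ^ 'n ^ 'n"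
  assumes S: "open S"
    and a: "\<And>i j. smooth_on S (\<lambda>u. a u $ i $ j)"
    and b: "\<And>i. smooth_on S (\<lambda>u. b u $ i)"
    and nz: "\<And>u. u \<in> S \<Longrightarrow> det (a u) \<noteq> 0"
    and eq: "\<And>u. u \<in> S \<Longrightarrow> a u *v z u = b u"
  shows "smooth_on S z"
proof (rule smooth_on_vec[OF S])
  fix k
  have "smooth_on S (\<lambda>u. det (\<chi> i j. if j = k then b u $ i else a u $ i $ j) / det (a u))"
  proof (intro smooth_on_divide smooth_on_det S nz)
    fix i j
    show "smooth_on S (\<lambda>u. (\<chi> i j. if j = k then b u $ i else a u $ i $ j) $ i $ j)"
      by (cases "j = k") (auto simp: a b)
  qed (use a in auto)
  then show "smooth_on S (\<lambda>u. z u $ k)"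
    by (rule smooth_on_cong[OF S]) (use eq in \<open>simp add: cramer[OF nz]\<close>)
qed

section \<open>Derivatives of smooth maps in varying directions\<close>

lemma smooth_on_differentiable: "smooth_on S f \<Longrightarrow> u \<in> S \<Longrightarrow> f differentiable (at u)"
  unfolding smooth_on_def by (metis times_differentiable_on.simps(2))

lemma smooth_on_continuous: "smooth_on S f \<Longrightarrow> continuous_on S f"
  unfolding smooth_on_def by (metis times_differentiable_on.simps(1))

lemma smooth_on_derivative_const:
  "smooth_on S f \<Longrightarrow> smooth_on S (\<lambda>u. frechet_derivative f (at u) w)"
  unfolding smooth_on_def by (metis times_differentiable_on.simps(2))

lemma frechet_derivative_Basis:
  fixes f :: "'e::euclidean_space \<Rightarrow> 'b::real_normed_vector"
  assumes "f differentiable (at u)"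
  shows "frechet_derivative f (at u) w = (\<Sum>i\<in>Basis. (w \<bullet> i) *\<^sub>R frechet_derivative f (at u) i)"
proof -
  interpret linear "frechet_derivative f (at u)"
    by (rule linear_frechet_derivative[OF assms])
  show ?thesis
    by (subst euclidean_representation[of w, symmetric]) (simp add: sum scale)
qed

text \<open>The definition of smoothness speaks of constant directions only. Expanding
  \<open>y u\<close> in the basis reduces a varying direction to these.\<close>

lemma smooth_on_derivative:
  fixes f :: "'e::euclidean_space \<Rightarrow> 'b::real_normed_vector"
  assumes S: "open S" and f: "smooth_on S f" and y: "smooth_on S y"
  shows "smooth_on S (\<lambda>u. frechet_derivative f (at u) (y u))"
proof -
  have "smooth_on S (\<lambda>u. \<Sum>i\<in>Basis. (y u \<bullet> i) *\<^sub>R frechet_derivative f (at u) i)"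
    by (intro smooth_on_sum smooth_on_scaleR smooth_on_inner S y smooth_on_const
        smooth_on_derivative_const f) auto
  then show ?thesis
    by (rule smooth_on_cong[OF S]) (simp add: frechet_derivative_Basis[OF smooth_on_differentiable[OF f]])
qed

text \<open>A product rule for the pairing of the derivative of \<open>f\<close> with
  \<open>y\<close>: the first summand differentiates the derivative of \<open>f\<close> with the
  direction frozen at \<open>y u\<close>, the second differentiates the direction.\<close>

lemma frechet_derivative_derivative:
  fixes f :: "'e::euclidean_space \<Rightarrow> 'b::real_normed_vector"
  assumes S: "open S" and f: "smooth_on S f" and y: "smooth_on S y" and u: "u \<in> S"
  shows "frechet_derivative (\<lambda>u. frechet_derivative f (at u) (y u)) (at u) w =
    frechet_derivative (\<lambda>v. frechet_derivative f (at v) (y u)) (at u) w +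
    frechet_derivative f (at u) (frechet_derivative y (at u) w)"
proof -
  let ?D = "\<lambda>v. frechet_derivative f (at v)"
  have dD: "((\<lambda>v. ?D v i) has_derivative frechet_derivative (\<lambda>v. ?D v i) (at u)) (at u)" for i
    using smooth_on_differentiable[OF smooth_on_derivative_const[OF f] u]
    by (simp add: frechet_derivative_works)
  have dy: "(y has_derivative frechet_derivative y (at u)) (at u)"
    using smooth_on_differentiable[OF y u] by (simp add: frechet_derivative_works)
  have "((\<lambda>v. \<Sum>i\<in>Basis. (y v \<bullet> i) *\<^sub>R ?D v i) has_derivative
      (\<lambda>w. \<Sum>i\<in>Basis. (y u \<bullet> i) *\<^sub>R frechet_derivative (\<lambda>v. ?D v i) (at u) w +
        (frechet_derivative y (at u) w \<bullet> i) *\<^sub>R ?D u i)) (at u)"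
    by (auto intro!: derivative_eq_intros dD dy)
  then have "((\<lambda>v. ?D v (y v)) has_derivative
      (\<lambda>w. \<Sum>i\<in>Basis. (y u \<bullet> i) *\<^sub>R frechet_derivative (\<lambda>v. ?D v i) (at u) w +
        (frechet_derivative y (at u) w \<bullet> i) *\<^sub>R ?D u i)) (at u)"
    by (rule has_derivative_transform_within_open[OF _ S u])
      (simp add: frechet_derivative_Basis[OF smooth_on_differentiable[OF f], symmetric])
  from frechet_derivative_at[OF this, symmetric]
  have 1: "frechet_derivative (\<lambda>v. ?D v (y v)) (at u) w =
      (\<Sum>i\<in>Basis. (y u \<bullet> i) *\<^sub>R frechet_derivative (\<lambda>v. ?D v i) (at u) w) +
      ?D u (frechet_derivative y (at u) w)"
    by (simp add: sum.distrib
        frechet_derivative_Basis[OF smooth_on_differentiable[OF f u], symmetric])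
  have "((\<lambda>v. \<Sum>i\<in>Basis. (y u \<bullet> i) *\<^sub>R ?D v i) has_derivative
      (\<lambda>w. \<Sum>i\<in>Basis. (y u \<bullet> i) *\<^sub>R frechet_derivative (\<lambda>v. ?D v i) (at u) w)) (at u)"
    by (auto intro!: derivative_eq_intros dD)
  then have "((\<lambda>v. ?D v (y u)) has_derivative
      (\<lambda>w. \<Sum>i\<in>Basis. (y u \<bullet> i) *\<^sub>R frechet_derivative (\<lambda>v. ?D v i) (at u) w)) (at u)"
    by (rule has_derivative_transform_within_open[OF _ S u])
      (simp add: frechet_derivative_Basis[OF smooth_on_differentiable[OF f], symmetric])
  from frechet_derivative_at[OF this, symmetric] 1 show ?thesis by simp
qed

subsection \<open>Symmetry of second derivatives\<close>

text \<open>The mean value theorem is applied twice: along \<open>v\<close> to the difference of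
  \<open>f\<close> on the two sides parallel to \<open>v\<close>, then along \<open>w\<close> to the
  directional derivative of \<open>f\<close> in direction \<open>v\<close>.\<close>

lemma second_difference_eq:
  fixes f :: "'e::euclidean_space \<Rightarrow> real"
  assumes f: "smooth_on S f" and t: "0 < t"
    and seg: "\<And>s r. \<lbrakk>0 \<le> s; s \<le> t; 0 \<le> r; r \<le> t\<rbrakk> \<Longrightarrow> p + s *\<^sub>R v + r *\<^sub>R w \<in> S"
  shows "\<exists>s r. 0 \<le> s \<and> s \<le> t \<and> 0 \<le> r \<and> r \<le> t \<and>
    f (p + t *\<^sub>R v + t *\<^sub>R w) - f (p + t *\<^sub>R v) - f (p + t *\<^sub>R w) + f p =
    t * t * frechet_derivative (\<lambda>u. frechet_derivative f (at u) v) (at (p + s *\<^sub>R v + r *\<^sub>R w)) w"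
proof -
  let ?D = "\<lambda>u. frechet_derivative f (at u)"
  let ?E = "\<lambda>u. frechet_derivative (\<lambda>u. ?D u v) (at u)"
  have df: "(f has_derivative ?D u) (at u)" if "u \<in> S" for u
    using smooth_on_differentiable[OF f that] by (simp add: frechet_derivative_works)
  have dE: "((\<lambda>u. ?D u v) has_derivative ?E u) (at u)" if "u \<in> S" for u
    using smooth_on_differentiable[OF smooth_on_derivative_const[OF f] that]
    by (simp add: frechet_derivative_works)
  have lin: "linear (?D u)" "linear (?E u)" if "u \<in> S" for u
    using df dE that has_derivative_linear by blast+
  have *: "((\<lambda>s. f (p + s *\<^sub>R v + r *\<^sub>R w)) has_derivative (\<lambda>h. h * ?D (p + s *\<^sub>R v + r *\<^sub>R w) v)) (at s within T)"
    if "0 \<le> s" "s \<le> t" "0 \<le> r" "r \<le> t" for s r T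
  proof -
    have "((\<lambda>s. p + s *\<^sub>R v + r *\<^sub>R w) has_derivative (\<lambda>h. h *\<^sub>R v)) (at s within T)"
      by (auto intro!: derivative_eq_intros)
    from has_derivative_compose[OF this df[OF seg[OF that]]]
    show ?thesis by (simp add: linear_scale[OF lin(1)[OF seg[OF that]]])
  qed
  have "\<exists>s\<in>{0<..<t}. (f (p + t *\<^sub>R v + t *\<^sub>R w) - f (p + t *\<^sub>R v + 0 *\<^sub>R w)) -
      (f (p + 0 *\<^sub>R v + t *\<^sub>R w) - f (p + 0 *\<^sub>R v + 0 *\<^sub>R w)) =
    (t - 0) * ?D (p + s *\<^sub>R v + t *\<^sub>R w) v - (t - 0) * ?D (p + s *\<^sub>R v + 0 *\<^sub>R w) v"
    by (rule mvt_simple[OF t]) (rule has_derivative_diff; rule *; use t in simp)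
  then obtain s where s: "0 < s" "s < t" and
    eq: "f (p + t *\<^sub>R v + t *\<^sub>R w) - f (p + t *\<^sub>R v) - f (p + t *\<^sub>R w) + f p =
      t * (?D (p + s *\<^sub>R v + t *\<^sub>R w) v - ?D (p + s *\<^sub>R v + 0 *\<^sub>R w) v)"
    by (auto simp: algebra_simps)
  have **: "((\<lambda>r. ?D (p + s *\<^sub>R v + r *\<^sub>R w) v) has_derivative
      (\<lambda>h. h * ?E (p + s *\<^sub>R v + r *\<^sub>R w) w)) (at r within T)"
    if r: "0 \<le> r" "r \<le> t" for r T
  proof -
    have m: "p + s *\<^sub>R v + r *\<^sub>R w \<in> S" using seg s r by simp
    have "((\<lambda>r. p + s *\<^sub>R v + r *\<^sub>R w) has_derivative (\<lambda>h. h *\<^sub>R w)) (at r within T)"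
      by (auto intro!: derivative_eq_intros)
    from has_derivative_compose[OF this dE[OF m]]
    show ?thesis by (simp add: linear_scale[OF lin(2)[OF m]])
  qed
  have "\<exists>r\<in>{0<..<t}. ?D (p + s *\<^sub>R v + t *\<^sub>R w) v - ?D (p + s *\<^sub>R v + 0 *\<^sub>R w) v =
      (t - 0) * ?E (p + s *\<^sub>R v + r *\<^sub>R w) w"
    by (rule mvt_simple[OF t]) (rule **; simp)
  then obtain r where "0 < r" "r < t"
    "?D (p + s *\<^sub>R v + t *\<^sub>R w) v - ?D (p + s *\<^sub>R v + 0 *\<^sub>R w) v = t * ?E (p + s *\<^sub>R v + r *\<^sub>R w) w"
    by auto
  with s eq show ?thesis
    by (intro exI[of _ s] exI[of _ r]) simp
qed

text \<open>The second difference over a small parallelogram does not change when \<open>v\<close>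
  and \<open>w\<close> are swapped. The two mixed derivatives therefore take a common value at two
  points close to \<open>p\<close>, and continuity carries this to \<open>p\<close> up to any
  \<open>e\<close>.\<close>

lemma second_derivative_symmetric_real:
  fixes f :: "'e::euclidean_space \<Rightarrow> real"
  assumes S: "open S" and f: "smooth_on S f" and p: "p \<in> S"
  shows "frechet_derivative (\<lambda>u. frechet_derivative f (at u) v) (at p) w =
    frechet_derivative (\<lambda>u. frechet_derivative f (at u) w) (at p) v"
proof -
  let ?E = "\<lambda>v w u. frechet_derivative (\<lambda>u. frechet_derivative f (at u) v) (at u) w"
  have cont: "isCont (?E v w) p" for v w
    using smooth_on_continuous[OF smooth_on_derivative_const[OF smooth_on_derivative_const[OF f]]] S p
    by (simp add: continuous_on_eq_continuous_at)
  have "\<bar>?E v w p - ?E w v p\<bar> \<le> e" if "e > 0" for e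
  proof -
    have "\<forall>\<^sub>F u in nhds p. u \<in> S \<and> \<bar>?E v w u - ?E v w p\<bar> < e / 2 \<and> \<bar>?E w v u - ?E w v p\<bar> < e / 2"
    proof (intro eventually_conj)
      have *: "\<forall>\<^sub>F u in nhds p. \<bar>?E v w u - ?E v w p\<bar> < e / 2" for v w
        using tendstoD[OF iffD1[OF tendsto_at_iff_tendsto_nhds cont[of v w, unfolded continuous_at]], of "e / 2"] that
        by (simp add: dist_real_def)
      show "\<forall>\<^sub>F u in nhds p. \<bar>?E v w u - ?E v w p\<bar> < e / 2" by (rule *)
      show "\<forall>\<^sub>F u in nhds p. \<bar>?E w v u - ?E w v p\<bar> < e / 2" by (rule *)
    qed (rule eventually_nhds_in_open[OF S p])
    then obtain d where d: "d > 0" and near: "\<And>u. dist u p < d \<Longrightarrow>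
        u \<in> S \<and> \<bar>?E v w u - ?E v w p\<bar> < e / 2 \<and> \<bar>?E w v u - ?E w v p\<bar> < e / 2"
      unfolding eventually_nhds_metric by blast
    \<comment> \<open>Small enough for the parallelogram with sides \<open>t *\<^sub>R v\<close> and
      \<open>t *\<^sub>R w\<close> to stay in the ball of radius \<open>d\<close>; the summand
      \<open>1\<close> keeps the denominator positive when \<open>v\<close> and \<open>w\<close>
      vanish.\<close>
    define t where "t = d / (2 * (norm v + norm w + 1))"
    have pos: "0 < norm v + norm w + 1"
      using norm_ge_zero[of v] norm_ge_zero[of w] by linarith
    have t: "0 < t" using d pos by (simp add: t_def)
    have td: "t * (norm v + norm w) < d"
    proof -
      have "t * (norm v + norm w) \<le> t * (norm v + norm w + 1)" using t by simp
      also have "\<dots> = d / 2" using pos by (simp add: t_def field_simps)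
      also have "\<dots> < d" using d by simp
      finally show ?thesis .
    qed
    have in_ball: "dist (p + s *\<^sub>R v + r *\<^sub>R w) p < d"
      if "0 \<le> s" "s \<le> t" "0 \<le> r" "r \<le> t" for s r
    proof -
      have "dist (p + s *\<^sub>R v + r *\<^sub>R w) p = norm (s *\<^sub>R v + r *\<^sub>R w)" by (simp add: dist_norm)
      also have "\<dots> \<le> s * norm v + r * norm w" using that norm_triangle_ineq[of "s *\<^sub>R v" "r *\<^sub>R w"] by simp
      also have "\<dots> \<le> t * norm v + t * norm w" by (intro add_mono mult_right_mono) (use that in auto)
      finally show ?thesis using td by (simp add: algebra_simps)
    qed
    have in_ball': "dist (p + s *\<^sub>R w + r *\<^sub>R v) p < d"
      if "0 \<le> s" "s \<le> t" "0 \<le> r" "r \<le> t" for s r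
      using in_ball[OF that(3,4,1,2)] by (simp add: algebra_simps)
    obtain s r where 1: "0 \<le> s" "s \<le> t" "0 \<le> r" "r \<le> t"
      "f (p + t *\<^sub>R v + t *\<^sub>R w) - f (p + t *\<^sub>R v) - f (p + t *\<^sub>R w) + f p = t * t * ?E v w (p + s *\<^sub>R v + r *\<^sub>R w)"
      using second_difference_eq[OF f t, of p v w] in_ball near by blast
    obtain s' r' where 2: "0 \<le> s'" "s' \<le> t" "0 \<le> r'" "r' \<le> t"
      "f (p + t *\<^sub>R w + t *\<^sub>R v) - f (p + t *\<^sub>R w) - f (p + t *\<^sub>R v) + f p = t * t * ?E w v (p + s' *\<^sub>R w + r' *\<^sub>R v)"
      using second_difference_eq[OF f t, of p w v] in_ball' near by blast
    have "t * t * ?E v w (p + s *\<^sub>R v + r *\<^sub>R w) = t * t * ?E w v (p + s' *\<^sub>R w + r' *\<^sub>R v)"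
      using 1(5) 2(5) by (simp add: algebra_simps)
    then have "?E v w (p + s *\<^sub>R v + r *\<^sub>R w) = ?E w v (p + s' *\<^sub>R w + r' *\<^sub>R v)" using t by simp
    then show ?thesis
      using near[OF in_ball[OF 1(1-4)]] near[OF in_ball'[OF 2(1-4)]] by linarith
  qed
  then have "\<bar>?E v w p - ?E w v p\<bar> \<le> 0" by (rule field_le_epsilon) simp
  then show ?thesis by simp
qed

text \<open>Reduction to the real-valued case: inner products with a fixed basis vector commute with
  both differentiations.\<close>

lemma second_derivative_symmetric:
  fixes f :: "'e::euclidean_space \<Rightarrow> 'b::euclidean_space"
  assumes S: "open S" and f: "smooth_on S f" and p: "p \<in> S"
  shows "frechet_derivative (\<lambda>u. frechet_derivative f (at u) v) (at p) w =
    frechet_derivative (\<lambda>u. frechet_derivative f (at u) w) (at p) v"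
proof (rule euclidean_eqI)
  fix b :: 'b
  have inner: "frechet_derivative (\<lambda>u. h u \<bullet> b) (at u) = (\<lambda>w. frechet_derivative h (at u) w \<bullet> b)"
    if "smooth_on S h" "u \<in> S" for h :: "'e \<Rightarrow> 'b" and u
  proof -
    have "(h has_derivative frechet_derivative h (at u)) (at u)"
      using smooth_on_differentiable[OF that] by (simp add: frechet_derivative_works)
    then show ?thesis by (intro frechet_derivative_at[symmetric] has_derivative_inner_left)
  qed
  have "frechet_derivative (\<lambda>u. frechet_derivative f (at u) v) (at p) w \<bullet> b =
      frechet_derivative (\<lambda>u. frechet_derivative (\<lambda>u. f u \<bullet> b) (at u) v) (at p) w" for v w
  proof -
    have "frechet_derivative (\<lambda>u. frechet_derivative f (at u) v \<bullet> b) (at p) =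
        frechet_derivative (\<lambda>u. frechet_derivative (\<lambda>u. f u \<bullet> b) (at u) v) (at p)"
    proof (rule frechet_derivative_transform_within_open[OF _ S p])
      show "(\<lambda>u. frechet_derivative f (at u) v \<bullet> b) differentiable at p"
        by (rule smooth_on_differentiable[OF smooth_on_inner[OF S smooth_on_derivative_const[OF f] smooth_on_const] p])
    qed (simp add: inner[OF f])
    then show ?thesis using inner[OF smooth_on_derivative_const[OF f] p] by metis
  qed
  then show "frechet_derivative (\<lambda>u. frechet_derivative f (at u) v) (at p) w \<bullet> b =
    frechet_derivative (\<lambda>u. frechet_derivative f (at u) w) (at p) v \<bullet> b"
    using second_derivative_symmetric_real[OF S smooth_on_inner[OF S f smooth_on_const] p] by simp
qed

section \<open>Manifolds with an atlas\<close>

locale manifold_atlas =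
  fixes M :: "'a topology" and A :: "('a, 'e::euclidean_space) chart set"
  assumes smooth_manifold: "smooth_manifold M A"
begin

section \<open>Charts and their overlaps\<close>

lemma charts_at_iff: "c \<in> charts_at A p \<longleftrightarrow> c \<in> A \<and> p \<in> fst c"
  by (auto simp: charts_at_def)

lemma fst_subset_topspace: "c \<in> A \<Longrightarrow> fst c \<subseteq> topspace M"
  using smooth_manifold by (auto simp: smooth_manifold_def)

lemma in_topspace: "c \<in> A \<Longrightarrow> q \<in> fst c \<Longrightarrow> q \<in> topspace M"
  using fst_subset_topspace by blast

lemma open_chart_range: "c \<in> A \<Longrightarrow> open (snd c ` fst c)"
  using smooth_manifold by (auto simp: smooth_manifold_def)

lemma inj_on_chart: "c \<in> A \<Longrightarrow> inj_on (snd c) (fst c)"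
  using smooth_manifold fst_subset_topspace[of c] homeomorphic_imp_injective_map
  unfolding smooth_manifold_def by (metis inf.absorb_iff2 topspace_subtopology)

lemma coord_rep_eq [simp]: "c \<in> A \<Longrightarrow> q \<in> fst c \<Longrightarrow> coord_rep c f (snd c q) = f q"
  by (simp add: coord_rep_def inj_on_chart)

lemma open_overlap:
  assumes "c \<in> A" "d \<in> A"
  shows "open (snd c ` (fst c \<inter> fst d))"
proof -
  have "open_map (subtopology M (fst c)) (top_of_set (snd c ` fst c)) (snd c)"
    using smooth_manifold assms(1) homeomorphic_imp_open_map unfolding smooth_manifold_def by blast
  moreover have "openin (subtopology M (fst c)) (fst c \<inter> fst d)"
    using smooth_manifold assms unfolding smooth_manifold_def
    by (auto simp: openin_subtopology_Int2)
  ultimately have "openin (top_of_set (snd c ` fst c)) (snd c ` (fst c \<inter> fst d))"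
    by (auto simp: open_map_def)
  then show ?thesis
    using open_chart_range[OF assms(1)] openin_open_eq by blast
qed

lemma exists_chart: "p \<in> topspace M \<Longrightarrow> \<exists>c. c \<in> charts_at A p"
  using smooth_manifold by (auto simp: smooth_manifold_def charts_at_def)

lemma charts_at_topspace: "c \<in> charts_at A p \<Longrightarrow> p \<in> topspace M"
  using charts_at_iff in_topspace by blast

section \<open>Change of charts and tangent vectors\<close>

lemma transition_differentiable:
  assumes "c \<in> charts_at A p" "d \<in> charts_at A p"
  shows "coord_rep c (snd d) differentiable (at (snd c p))"
  using smooth_manifold assms unfolding smooth_manifold_def charts_at_def
  by (intro smooth_on_differentiable[of "snd c ` (fst c \<inter> fst d)"]) auto

text \<open>Chain rule through the transition map. The factorization of \<open>coord_rep c f\<close>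
  holds only on the image of the overlap, which is open.\<close>

lemma coord_rep_has_derivative:
  assumes c: "c \<in> charts_at A p" and d: "d \<in> charts_at A p"
    and f: "coord_rep d f differentiable (at (snd d p))"
  shows "(coord_rep c f has_derivative (\<lambda>w. frechet_derivative (coord_rep d f) (at (snd d p))
      (frechet_derivative (coord_rep c (snd d)) (at (snd c p)) w))) (at (snd c p))"
proof -
  have cd: "c \<in> A" "d \<in> A" "p \<in> fst c" "p \<in> fst d" using c d by (auto simp: charts_at_def)
  have "(coord_rep c (snd d) has_derivative frechet_derivative (coord_rep c (snd d)) (at (snd c p)))
      (at (snd c p))"
    using transition_differentiable[OF c d] by (simp add: frechet_derivative_works)
  moreover have "(coord_rep d f has_derivative frechet_derivative (coord_rep d f) (at (snd d p)))
      (at (coord_rep c (snd d) (snd c p)))"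
    using f cd by (simp add: frechet_derivative_works)
  ultimately have "((\<lambda>u. coord_rep d f (coord_rep c (snd d) u)) has_derivative
      (\<lambda>w. frechet_derivative (coord_rep d f) (at (snd d p))
      (frechet_derivative (coord_rep c (snd d)) (at (snd c p)) w))) (at (snd c p))"
    by (rule has_derivative_compose)
  then show ?thesis
  proof (rule has_derivative_transform_within_open[OF _ open_overlap[OF cd(1,2)]])
    show "snd c p \<in> snd c ` (fst c \<inter> fst d)" using cd by blast
    fix u assume "u \<in> snd c ` (fst c \<inter> fst d)"
    then obtain q where "u = snd c q" "q \<in> fst c" "q \<in> fst d" by blast
    then show "coord_rep d f (coord_rep c (snd d) u) = coord_rep c f u" using cd by simp
  qed
qed

lemma coord_rep_derivative:
  assumes "c \<in> charts_at A p" "d \<in> charts_at A p" "coord_rep d f differentiable (at (snd d p))"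
  shows "frechet_derivative (coord_rep c f) (at (snd c p)) w =
    frechet_derivative (coord_rep d f) (at (snd d p))
      (frechet_derivative (coord_rep c (snd d)) (at (snd c p)) w)"
  by (rule fun_cong[OF frechet_derivative_at[OF coord_rep_has_derivative[OF assms], symmetric]])

lemma tangent_space_transition:
  assumes "v \<in> tangent_space A p" "c \<in> charts_at A p" "d \<in> charts_at A p"
  shows "v d = frechet_derivative (coord_rep c (snd d)) (at (snd c p)) (v c)"
  using assms unfolding tangent_space_def by blast

lemma tangent_spaceI:
  assumes "\<And>c d. c \<in> charts_at A p \<Longrightarrow> d \<in> charts_at A p \<Longrightarrow>
      v d = frechet_derivative (coord_rep c (snd d)) (at (snd c p)) (v c)"
    and "\<And>c. c \<notin> charts_at A p \<Longrightarrow> v c = 0"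
  shows "v \<in> tangent_space A p"
  using assms unfolding tangent_space_def by blast

lemma tangent_space_outside: "v \<in> tangent_space A p \<Longrightarrow> c \<notin> charts_at A p \<Longrightarrow> v c = 0"
  unfolding tangent_space_def by blast

text \<open>The prescribed component \<open>e\<close> is transported to all other charts by the
  derivatives of the transition maps. The chain rule makes the resulting family obey the
  transformation law.\<close>

lemma tangent_space_exists:
  assumes c: "c \<in> charts_at A p"
  shows "\<exists>v\<in>tangent_space A p. v c = e"
proof
  let ?v = "\<lambda>d. if d \<in> charts_at A p
    then frechet_derivative (coord_rep c (snd d)) (at (snd c p)) e else 0"
  show "?v \<in> tangent_space A p"
  proof (rule tangent_spaceI)
    fix d d' assume d: "d \<in> charts_at A p" "d' \<in> charts_at A p"
    have "frechet_derivative (coord_rep c (snd d')) (at (snd c p)) e =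
        frechet_derivative (coord_rep d (snd d')) (at (snd d p))
          (frechet_derivative (coord_rep c (snd d)) (at (snd c p)) e)"
      by (rule coord_rep_derivative[OF c d(1) transition_differentiable[OF d]])
    with d show "?v d' = frechet_derivative (coord_rep d (snd d')) (at (snd d p)) (?v d)"
      by (simp only: if_True)
  qed simp
  \<comment> \<open>The transition from \<open>c\<close> to itself is the identity on the chart
    range, so the component in \<open>c\<close> is \<open>e\<close> itself.\<close>
  have cA: "c \<in> A" "p \<in> fst c" using c by (auto simp: charts_at_def)
  have "((\<lambda>u. u) has_derivative (\<lambda>w. w)) (at (snd c p))" by (rule has_derivative_ident)
  then have "(coord_rep c (snd c) has_derivative (\<lambda>w. w)) (at (snd c p))"
    by (rule has_derivative_transform_within_open[OF _ open_chart_range[OF cA(1)]]) (use cA in auto)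
  then have "frechet_derivative (coord_rep c (snd c)) (at (snd c p)) = (\<lambda>w. w)"
    by (rule frechet_derivative_at[symmetric])
  then show "?v c = e" using c by simp
qed

lemma tangent_space_scaleR:
  assumes "v \<in> tangent_space A p"
  shows "(\<lambda>c. r *\<^sub>R v c) \<in> tangent_space A p"
proof (rule tangent_spaceI)
  fix c d assume cd: "c \<in> charts_at A p" "d \<in> charts_at A p"
  show "r *\<^sub>R v d = frechet_derivative (coord_rep c (snd d)) (at (snd c p)) (r *\<^sub>R v c)"
    using tangent_space_transition[OF assms cd]
      linear_scale[OF linear_frechet_derivative[OF transition_differentiable[OF cd]]] by metis
qed (simp add: assms[THEN tangent_space_outside])

section \<open>Smooth maps and their differentials\<close>

lemma differential_eq':
  assumes c: "c \<in> charts_at A p" and v: "v \<in> tangent_space A p"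
    and f: "coord_rep c f differentiable (at (snd c p))"
  shows "differential A f p v = frechet_derivative (coord_rep c f) (at (snd c p)) (v c)"
proof -
  \<comment> \<open>This is the chart hidden in \<open>differential\<close>. The chain rule for
    \<open>f\<close> and the transformation law for \<open>v\<close> cancel the change from
    \<open>c0\<close> to \<open>c\<close>.\<close>
  define c0 where "c0 = (SOME c. c \<in> charts_at A p)"
  have c0: "c0 \<in> charts_at A p" unfolding c0_def using c by (rule someI)
  show ?thesis
    using coord_rep_derivative[OF c0 c f] tangent_space_transition[OF v c0 c]
    unfolding differential_def Let_def c0_def[symmetric] by simp
qed

lemma smooth_map_chart_differentiable:
  "smooth_map A f \<Longrightarrow> c \<in> charts_at A p \<Longrightarrow> coord_rep c f differentiable (at (snd c p))"
  by (auto simp: smooth_map_def charts_at_def intro: smooth_on_differentiable)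

lemma differential_eq:
  assumes "c \<in> charts_at A p" "v \<in> tangent_space A p" "smooth_map A f"
  shows "differential A f p v = frechet_derivative (coord_rep c f) (at (snd c p)) (v c)"
  using differential_eq'[OF assms(1,2) smooth_map_chart_differentiable[OF assms(3,1)]] .

lemma smooth_mapI:
  assumes "\<And>c. c \<in> A \<Longrightarrow> smooth_on (snd c ` fst c) (f' c)"
    and "\<And>c q. c \<in> A \<Longrightarrow> q \<in> fst c \<Longrightarrow> f' c (snd c q) = f q"
  shows "smooth_map A f"
  unfolding smooth_map_def
proof
  fix c assume c: "c \<in> A"
  show "smooth_on (snd c ` fst c) (coord_rep c f)"
    by (rule smooth_on_cong[OF open_chart_range[OF c] assms(1)[OF c]]) (auto simp: c assms(2)[OF c])
qed

lemma smooth_map_cong: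
  assumes "smooth_map A f" "\<And>q. q \<in> topspace M \<Longrightarrow> f q = h q"
  shows "smooth_map A h"
proof (rule smooth_mapI)
  show "smooth_on (snd c ` fst c) (coord_rep c f)" if "c \<in> A" for c
    using assms(1) that by (simp add: smooth_map_def)
  show "coord_rep c f (snd c q) = h q" if "c \<in> A" "q \<in> fst c" for c q
    using that assms(2)[OF in_topspace[OF that]] by simp
qed

text \<open>Identities between maps on the manifold, such as orthogonality or the formula for the
  induced metric, are available on \<open>topspace M\<close> only; this lemma allows them to be
  differentiated.\<close>

lemma differential_cong:
  assumes f: "smooth_map A f" and fh: "\<And>q. q \<in> topspace M \<Longrightarrow> f q = h q"
    and p: "p \<in> topspace M" and v: "v \<in> tangent_space A p"
  shows "differential A f p v = differential A h p v"
proof -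
  obtain c where c: "c \<in> charts_at A p" using exists_chart[OF p] ..
  then have cA: "c \<in> A" "p \<in> fst c" by (auto simp: charts_at_def)
  have "frechet_derivative (coord_rep c f) (at (snd c p)) = frechet_derivative (coord_rep c h) (at (snd c p))"
    by (rule frechet_derivative_transform_within_open[OF smooth_map_chart_differentiable[OF f c]
          open_chart_range[OF cA(1)]]) (auto simp: cA fh in_topspace[OF cA(1)])
  then show ?thesis
    using differential_eq[OF c v f] differential_eq[OF c v smooth_map_cong[OF f fh]] by simp
qed

lemma smooth_map_const: "smooth_map A (\<lambda>_. a)"
  by (rule smooth_mapI[of "\<lambda>_ _. a"]) (auto intro: smooth_on_const)

lemma smooth_map_diff:
  fixes f h :: "'a \<Rightarrow> 'b::real_normed_vector"
  assumes "smooth_map A f" "smooth_map A h"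
  shows "smooth_map A (\<lambda>q. f q - h q)"
proof (rule smooth_mapI)
  fix c assume c: "c \<in> A"
  show "smooth_on (snd c ` fst c) (\<lambda>u. coord_rep c f u + - coord_rep c h u)"
    using assms c
    by (intro smooth_on_add smooth_on_linear[OF bounded_linear_minus[OF bounded_linear_ident]]
        open_chart_range) (auto simp: smooth_map_def)
qed auto

lemma smooth_map_inner:
  assumes "smooth_map A f" "smooth_map A h"
  shows "smooth_map A (\<lambda>q. f q \<bullet> h q)"
proof (rule smooth_mapI)
  fix c assume c: "c \<in> A"
  show "smooth_on (snd c ` fst c) (\<lambda>u. coord_rep c f u \<bullet> coord_rep c h u)"
    using assms c by (intro smooth_on_inner open_chart_range) (auto simp: smooth_map_def)
qed auto

lemma differential_diff:
  assumes f: "smooth_map A f" and h: "smooth_map A h"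
    and p: "p \<in> topspace M" and v: "v \<in> tangent_space A p"
  shows "differential A (\<lambda>q. f q - h q) p v = differential A f p v - differential A h p v"
proof -
  obtain c where c: "c \<in> charts_at A p" using exists_chart[OF p] ..
  have "((\<lambda>u. coord_rep c f u - coord_rep c h u) has_derivative
      (\<lambda>w. frechet_derivative (coord_rep c f) (at (snd c p)) w -
        frechet_derivative (coord_rep c h) (at (snd c p)) w)) (at (snd c p))"
    using smooth_map_chart_differentiable[OF f c] smooth_map_chart_differentiable[OF h c]
    by (auto simp: frechet_derivative_works intro: has_derivative_diff)
  moreover have "(\<lambda>u. coord_rep c f u - coord_rep c h u) = coord_rep c (\<lambda>q. f q - h q)"
    by (auto simp: coord_rep_def)
  ultimately have "frechet_derivative (coord_rep c (\<lambda>q. f q - h q)) (at (snd c p)) =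
      (\<lambda>w. frechet_derivative (coord_rep c f) (at (snd c p)) w -
        frechet_derivative (coord_rep c h) (at (snd c p)) w)"
    by (intro frechet_derivative_at[symmetric]) simp
  then show ?thesis
    by (simp add: differential_eq[OF c v] f h smooth_map_diff[OF f h])
qed

lemma differential_inner:
  assumes f: "smooth_map A f" and h: "smooth_map A h"
    and p: "p \<in> topspace M" and v: "v \<in> tangent_space A p"
  shows "differential A (\<lambda>q. f q \<bullet> h q) p v = f p \<bullet> differential A h p v + differential A f p v \<bullet> h p"
proof -
  obtain c where c: "c \<in> charts_at A p" using exists_chart[OF p] ..
  have "((\<lambda>u. coord_rep c f u \<bullet> coord_rep c h u) has_derivative
      (\<lambda>w. coord_rep c f (snd c p) \<bullet> frechet_derivative (coord_rep c h) (at (snd c p)) w +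
        frechet_derivative (coord_rep c f) (at (snd c p)) w \<bullet> coord_rep c h (snd c p))) (at (snd c p))"
    using smooth_map_chart_differentiable[OF f c] smooth_map_chart_differentiable[OF h c]
    by (auto simp: frechet_derivative_works intro: has_derivative_inner)
  moreover have "(\<lambda>u. coord_rep c f u \<bullet> coord_rep c h u) = coord_rep c (\<lambda>q. f q \<bullet> h q)"
    by (auto simp: coord_rep_def)
  moreover have "coord_rep c f (snd c p) = f p" "coord_rep c h (snd c p) = h p"
    using c by (auto simp: charts_at_def)
  ultimately have "frechet_derivative (coord_rep c (\<lambda>q. f q \<bullet> h q)) (at (snd c p)) =
      (\<lambda>w. f p \<bullet> frechet_derivative (coord_rep c h) (at (snd c p)) w +
        frechet_derivative (coord_rep c f) (at (snd c p)) w \<bullet> h p)"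
    by (intro frechet_derivative_at[symmetric]) simp
  then show ?thesis
    by (simp add: differential_eq[OF c v] f h smooth_map_inner[OF f h])
qed

section \<open>Derivatives along vector fields and the Lie bracket\<close>

lemma smooth_vector_field_tangent:
  "smooth_vector_field M A Y \<Longrightarrow> p \<in> topspace M \<Longrightarrow> Y p \<in> tangent_space A p"
  by (simp add: smooth_vector_field_def)

lemma differential_field_chart:
  assumes "smooth_map A f" "smooth_vector_field M A Y" "c \<in> A" "q \<in> fst c"
  shows "differential A f q (Y q) =
    frechet_derivative (coord_rep c f) (at (snd c q)) (coord_rep c (\<lambda>p. Y p c) (snd c q))"
  using assms in_topspace[OF assms(3,4)]
  by (subst differential_eq[of c]) (simp_all add: charts_at_iff smooth_vector_field_tangent)

lemma smooth_map_differential: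
  fixes f :: "'a \<Rightarrow> 'b::real_normed_vector"
  assumes f: "smooth_map A f" and Y: "smooth_vector_field M A Y"
  shows "smooth_map A (\<lambda>q. differential A f q (Y q))"
proof (rule smooth_mapI)
  fix c assume c: "c \<in> A"
  show "smooth_on (snd c ` fst c)
      (\<lambda>u. frechet_derivative (coord_rep c f) (at u) (coord_rep c (\<lambda>p. Y p c) u))"
    using f Y c by (intro smooth_on_derivative open_chart_range)
      (auto simp: smooth_map_def smooth_vector_field_def)
qed (simp add: differential_field_chart[OF f Y])

text \<open>In a chart each iterated derivative is a second derivative of \<open>f\<close> plus a
  first derivative of \<open>f\<close> along a derivative of the field. The second derivatives
  cancel by symmetry, and what remains is the coordinate formula for the bracket.\<close>

lemma differential_differential_commutator:
  fixes f :: "'a \<Rightarrow> 'b::euclidean_space"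
  assumes f: "smooth_map A f" and X: "smooth_vector_field M A X" and Y: "smooth_vector_field M A Y"
    and c: "c \<in> charts_at A p"
  shows "differential A (\<lambda>q. differential A f q (Y q)) p (X p) -
      differential A (\<lambda>q. differential A f q (X q)) p (Y p) =
    frechet_derivative (coord_rep c f) (at (snd c p)) (lie_bracket A X Y p c)"
proof -
  let ?f = "coord_rep c f" and ?u = "snd c p"
  have cA: "c \<in> A" "p \<in> fst c" using c by (auto simp: charts_at_def)
  let ?U = "snd c ` fst c"
  have U: "open ?U" "?u \<in> ?U" using open_chart_range cA by auto
  have fs: "smooth_on ?U ?f" using f cA by (simp add: smooth_map_def)
  have *: "differential A (\<lambda>q. differential A f q (Y q)) p (X p) =
      frechet_derivative (\<lambda>v. frechet_derivative ?f (at v) (Y p c)) (at ?u) (X p c) +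
      frechet_derivative ?f (at ?u) (frechet_derivative (coord_rep c (\<lambda>q. Y q c)) (at ?u) (X p c))"
    if X: "smooth_vector_field M A X" and Y: "smooth_vector_field M A Y" for X Y
  proof -
    let ?y = "coord_rep c (\<lambda>q. Y q c)"
    have ys: "smooth_on ?U ?y" using Y cA by (simp add: smooth_vector_field_def)
    have "frechet_derivative (\<lambda>v. frechet_derivative ?f (at v) (?y v)) (at ?u) =
        frechet_derivative (coord_rep c (\<lambda>q. differential A f q (Y q))) (at ?u)"
      by (rule frechet_derivative_transform_within_open[OF
            smooth_on_differentiable[OF smooth_on_derivative[OF U(1) fs ys] U(2)] U])
        (use cA in \<open>auto simp: differential_field_chart[OF f Y]\<close>)
    moreover have "differential A (\<lambda>q. differential A f q (Y q)) p (X p) =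
        frechet_derivative (coord_rep c (\<lambda>q. differential A f q (Y q))) (at ?u) (X p c)"
      using X charts_at_topspace[OF c]
      by (intro differential_eq[OF c] smooth_map_differential f Y smooth_vector_field_tangent)
    moreover have "?y ?u = Y p c" using cA by simp
    ultimately show ?thesis
      using frechet_derivative_derivative[OF U(1) fs ys U(2)] by simp
  qed
  have lin: "linear (frechet_derivative ?f (at ?u))"
    by (rule linear_frechet_derivative[OF smooth_on_differentiable[OF fs U(2)]])
  show ?thesis
    using *[OF X Y] *[OF Y X] second_derivative_symmetric[OF U(1) fs U(2), of "Y p c" "X p c"] c
    by (simp add: lie_bracket_def linear_diff[OF lin])
qed

end

section \<open>Submanifolds of Euclidean space\<close>

text \<open>Coordinates live in \<open>real ^ 'n\<close> so that the Gram matrix of the Jacobian has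
  a determinant and Cramer's rule applies to it.\<close>

locale euclidean_immersion =
  fixes M :: "'a topology" and A :: "('a, real ^ 'n) chart set"
    and g :: "('a, real ^ 'n) metric" and x :: "'a \<Rightarrow> 'b::euclidean_space"
  assumes submanifold: "euclidean_submanifold M A g x"
begin

sublocale manifold_atlas M A
  using submanifold by unfold_locales (auto simp: euclidean_submanifold_def riemannian_manifold_def)

lemma smooth_immersion: "smooth_map A x"
  using submanifold by (simp add: euclidean_submanifold_def)

lemma inj_on_differential:
  "p \<in> topspace M \<Longrightarrow> inj_on (differential A x p) (tangent_space A p)"
  using submanifold by (simp add: euclidean_submanifold_def)

lemma metric_eq:
  "p \<in> topspace M \<Longrightarrow> u \<in> tangent_space A p \<Longrightarrow> v \<in> tangent_space A p \<Longrightarrow>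
    g p u v = differential A x p u \<bullet> differential A x p v"
  using submanifold by (simp add: euclidean_submanifold_def)

section \<open>Tangent planes\<close>

lemma differential_in_tangent_plane:
  "v \<in> tangent_space A p \<Longrightarrow> differential A x p v \<in> tangent_plane A x p"
  by (simp add: tangent_plane_def)

lemma tangent_plane_eq_range:
  assumes c: "c \<in> charts_at A p"
  shows "tangent_plane A x p = range (frechet_derivative (coord_rep c x) (at (snd c p)))"
proof -
  have "\<exists>v\<in>tangent_space A p. frechet_derivative (coord_rep c x) (at (snd c p)) w = differential A x p v" for w
    using tangent_space_exists[OF c, of w] differential_eq[OF c _ smooth_immersion] by metis
  then show ?thesis
    using differential_eq[OF c _ smooth_immersion] by (auto simp: tangent_plane_def)
qed

text \<open>Every coordinate vector is the component of a tangent vector, so injectivity of the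
  differential passes to the Jacobian in a chart.\<close>

lemma chart_derivative_eq_0:
  assumes c: "c \<in> charts_at A p" and "frechet_derivative (coord_rep c x) (at (snd c p)) w = 0"
  shows "w = 0"
proof -
  have p: "p \<in> topspace M" by (rule charts_at_topspace[OF c])
  have lin: "linear (frechet_derivative (coord_rep c x) (at (snd c p)))"
    by (rule linear_frechet_derivative[OF smooth_map_chart_differentiable[OF smooth_immersion c]])
  obtain v where v: "v \<in> tangent_space A p" "v c = w" using tangent_space_exists[OF c] by blast
  \<comment> \<open>\<open>o'\<close> plays the part of the zero tangent vector; only its component
    in \<open>c\<close> matters.\<close>
  obtain o' where o': "o' \<in> tangent_space A p" "o' c = 0" using tangent_space_exists[OF c] by blast
  have "differential A x p v = differential A x p o'"
    using differential_eq[OF c v(1) smooth_immersion] differential_eq[OF c o'(1) smooth_immersion]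
      v o' assms(2) linear_0[OF lin] by simp
  then have "v = o'" using inj_on_differential[OF p] v o' by (auto dest: inj_onD)
  then show ?thesis using v o' by simp
qed

lemma subspace_tangent_plane:
  assumes p: "p \<in> topspace M"
  shows "subspace (tangent_plane A x p)"
proof -
  obtain c where c: "c \<in> charts_at A p" using exists_chart[OF p] ..
  have "linear (frechet_derivative (coord_rep c x) (at (snd c p)))"
    by (rule linear_frechet_derivative[OF smooth_map_chart_differentiable[OF smooth_immersion c]])
  from linear_subspace_image[OF this subspace_UNIV] show ?thesis
    by (simp add: tangent_plane_eq_range[OF c])
qed

section \<open>Orthogonal projection to the tangent plane\<close>

lemma tangential_part_eqI:
  assumes p: "p \<in> topspace M" and t: "t \<in> tangent_plane A x p"
    and orth: "\<And>s. s \<in> tangent_plane A x p \<Longrightarrow> (w - t) \<bullet> s = 0"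
  shows "tangential_part A x p w = t"
  unfolding tangential_part_def
proof (rule the_equality)
  fix t' assume t': "t' \<in> tangent_plane A x p \<and> (\<forall>s\<in>tangent_plane A x p. (w - t') \<bullet> s = 0)"
  then have d: "t - t' \<in> tangent_plane A x p"
    using t subspace_diff[OF subspace_tangent_plane[OF p]] by blast
  \<comment> \<open>Two candidates differ by a tangent vector that is orthogonal to the tangent
    plane, hence to itself.\<close>
  have "(t - t') \<bullet> (t - t') = (w - t') \<bullet> (t - t') - (w - t) \<bullet> (t - t')"
    by (simp add: algebra_simps)
  also have "\<dots> = 0" using t' orth[OF d] d by simp
  finally show "t' = t" by simp
qed (use t orth in blast)

text \<open>Orthogonal decomposition gives existence and \<open>tangential_part_eqI\<close>
  uniqueness, so the definite description in \<open>tangential_part\<close> denotes the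
  projection.\<close>

lemma tangential_part_props:
  assumes p: "p \<in> topspace M"
  shows "tangential_part A x p w \<in> tangent_plane A x p"
    and "s \<in> tangent_plane A x p \<Longrightarrow> (w - tangential_part A x p w) \<bullet> s = 0"
proof -
  have span: "span (tangent_plane A x p) = tangent_plane A x p"
    using subspace_tangent_plane[OF p] by simp
  obtain y z where y: "y \<in> tangent_plane A x p"
    and z: "\<And>s. s \<in> tangent_plane A x p \<Longrightarrow> orthogonal z s" and w: "w = y + z"
    using orthogonal_subspace_decomp_exists[of "tangent_plane A x p" w] unfolding span by metis
  have "tangential_part A x p w = y"
    by (rule tangential_part_eqI[OF p y]) (use z w in \<open>simp add: orthogonal_def\<close>)
  then show "tangential_part A x p w \<in> tangent_plane A x p"
    and "s \<in> tangent_plane A x p \<Longrightarrow> (w - tangential_part A x p w) \<bullet> s = 0"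
    using y z w by (auto simp: orthogonal_def)
qed

lemma normal_part_inner:
  assumes "p \<in> topspace M" "s \<in> tangent_plane A x p"
  shows "normal_part A x p w \<bullet> s = 0"
  using tangential_part_props(2)[OF assms] by (simp add: normal_part_def)

lemma tangential_part_of_tangent:
  "p \<in> topspace M \<Longrightarrow> t \<in> tangent_plane A x p \<Longrightarrow> tangential_part A x p t = t"
  by (rule tangential_part_eqI) auto

lemma tangential_part_diff:
  assumes p: "p \<in> topspace M"
  shows "tangential_part A x p (v - w) = tangential_part A x p v - tangential_part A x p w"
proof (rule tangential_part_eqI[OF p])
  show "tangential_part A x p v - tangential_part A x p w \<in> tangent_plane A x p"
    by (intro subspace_diff subspace_tangent_plane tangential_part_props p)
  fix s assume "s \<in> tangent_plane A x p"
  from tangential_part_props(2)[OF p this, of v] tangential_part_props(2)[OF p this, of w]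
  show "(v - w - (tangential_part A x p v - tangential_part A x p w)) \<bullet> s = 0"
    by (simp add: inner_diff_left)
qed

section \<open>Tangent fields obtained by projecting ambient maps\<close>

definition tangential_field :: "('a \<Rightarrow> 'b) \<Rightarrow> ('a, real ^ 'n) field" where
  "tangential_field W p =
    inv_into (tangent_space A p) (differential A x p) (tangential_part A x p (W p))"

lemma tangential_field_props:
  assumes p: "p \<in> topspace M"
  shows "tangential_field W p \<in> tangent_space A p"
    and "differential A x p (tangential_field W p) = tangential_part A x p (W p)"
  using tangential_part_props(1)[OF p, of "W p"] unfolding tangential_field_def tangent_plane_def
  by (simp_all add: inv_into_into f_inv_into_f)

text \<open>In a chart, the components of the tangential part of \<open>W\<close> solve the normal equations
  \<open>J\<^sup>T J z = J\<^sup>T W\<close>, where \<open>J\<close> is the Jacobian of the immersion.\<close>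

lemma smooth_tangential_field:
  assumes W: "smooth_map A W"
  shows "smooth_vector_field M A (tangential_field W)"
  unfolding smooth_vector_field_def
proof (intro conjI ballI)
  fix p assume "p \<in> topspace M"
  then show "tangential_field W p \<in> tangent_space A p" by (rule tangential_field_props)
next
  fix c assume c: "c \<in> A"
  let ?U = "snd c ` fst c" and ?J = "\<lambda>u. frechet_derivative (coord_rep c x) (at u)"
  let ?a = "\<lambda>u. (\<chi> i j. ?J u (axis i 1) \<bullet> ?J u (axis j 1)) :: real ^ 'n ^ 'n"
  let ?b = "\<lambda>u. (\<chi> i. ?J u (axis i 1) \<bullet> coord_rep c W u) :: real ^ 'n"
  let ?z = "coord_rep c (\<lambda>p. tangential_field W p c)"
  have U: "open ?U" by (rule open_chart_range[OF c])
  have xs: "smooth_on ?U (coord_rep c x)" and Ws: "smooth_on ?U (coord_rep c W)"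
    using smooth_immersion W c by (auto simp: smooth_map_def)
  have J_expand: "?J u y = (\<Sum>j\<in>UNIV. (y $ j) *\<^sub>R ?J u (axis j 1))"
    if u: "u \<in> ?U" for u and y :: "real ^ 'n"
  proof -
    have lin: "linear (?J u)"
      by (rule linear_frechet_derivative[OF smooth_on_differentiable[OF xs u]])
    have "?J u y = ?J u (\<Sum>j\<in>UNIV. (y $ j) *\<^sub>R axis j 1)"
      by (simp add: basis_expansion scalar_mult_eq_scaleR[symmetric])
    also have "\<dots> = (\<Sum>j\<in>UNIV. (y $ j) *\<^sub>R ?J u (axis j 1))"
      by (simp add: linear_sum[OF lin] linear_scale[OF lin])
    finally show ?thesis .
  qed
  have a_mult: "?a u *v y = (\<chi> i. ?J u (axis i 1) \<bullet> ?J u y)" if u: "u \<in> ?U" for u and y :: "real ^ 'n"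
    by (subst J_expand[OF u, of y]) (simp add: matrix_vector_mult_def inner_sum_right mult.commute)
  show "smooth_on ?U ?z"
  proof (rule smooth_on_solution[OF U, of ?a ?b])
    show "smooth_on ?U (\<lambda>u. ?a u $ i $ j)" for i j
      by simp (intro smooth_on_inner smooth_on_derivative_const U xs)
    show "smooth_on ?U (\<lambda>u. ?b u $ i)" for i
      by simp (intro smooth_on_inner smooth_on_derivative_const U xs Ws)
  next
    fix u assume u: "u \<in> ?U"
    then obtain q where q: "q \<in> fst c" "u = snd c q" by auto
    have cq: "c \<in> charts_at A q" using c q by (simp add: charts_at_iff)
    \<comment> \<open>The Gram matrix is nonsingular: if it kills \<open>y\<close>, then
      \<open>?J u y\<close> is orthogonal to the columns of the Jacobian, hence to itself, and the
      Jacobian is injective.\<close>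
    have "y = 0" if y: "?a u *v y = 0" for y
    proof -
      have "?J u (axis i 1) \<bullet> ?J u y = 0" for i
        using y unfolding a_mult[OF u] by (simp add: vec_eq_iff)
      moreover have "?J u y \<bullet> ?J u y = (\<Sum>j\<in>UNIV. (y $ j) *\<^sub>R ?J u (axis j 1)) \<bullet> ?J u y"
        by (rule arg_cong[where f = "\<lambda>v. v \<bullet> ?J u y", OF J_expand[OF u]])
      ultimately have "?J u y = 0" by (simp add: inner_sum_left)
      then show ?thesis using chart_derivative_eq_0[OF cq] q by simp
    qed
    then show "det (?a u) \<noteq> 0"
      by (simp add: invertible_det_nz[symmetric] invertible_left_inverse matrix_left_invertible_ker)
    have M: "q \<in> topspace M" by (rule charts_at_topspace[OF cq])
    have z: "?J u (?z u) = tangential_part A x q (W q)"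
      using tangential_field_props[OF M, of W] differential_eq[OF cq _ smooth_immersion] q c by simp
    \<comment> \<open>The range of the Jacobian is the tangent plane, to which \<open>W\<close>
      minus its tangential part is orthogonal. Taking axis vectors for \<open>w\<close> gives the
      normal equations.\<close>
    have "?J u w \<bullet> ?J u (?z u) = ?J u w \<bullet> coord_rep c W u" for w
    proof -
      have "?J u w \<in> tangent_plane A x q" using q by (simp add: tangent_plane_eq_range[OF cq])
      from tangential_part_props(2)[OF M this, of "W q"] show ?thesis
        unfolding z using q c by (simp add: inner_diff_left inner_commute)
    qed
    then show "?a u *v ?z u = ?b u" by (simp add: a_mult[OF u])
  qed
qed

text \<open>The constant ambient vector \<open>differential A x p v\<close> is projected to all
  tangent planes. At \<open>p\<close> it is already tangent, so the projection fixes it and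
  injectivity of the differential recovers \<open>v\<close>.\<close>

lemma exists_smooth_extension:
  assumes p: "p \<in> topspace M" and v: "v \<in> tangent_space A p"
  shows "\<exists>Y. smooth_vector_field M A Y \<and> Y p = v"
proof (intro exI conjI)
  let ?Y = "tangential_field (\<lambda>_. differential A x p v)"
  show "smooth_vector_field M A ?Y" by (rule smooth_tangential_field[OF smooth_map_const])
  have "differential A x p (?Y p) = differential A x p v"
    using tangential_field_props(2)[OF p]
      tangential_part_of_tangent[OF p differential_in_tangent_plane[OF v]] by simp
  then show "?Y p = v"
    using inj_on_differential[OF p] tangential_field_props(1)[OF p] v by (auto dest: inj_onD)
qed

section \<open>Flat derivatives of tangent fields and the second fundamental form\<close>

definition push :: "('a, real ^ 'n) field \<Rightarrow> 'a \<Rightarrow> 'b" where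
  "push Y q = differential A x q (Y q)"

lemma smooth_push: "smooth_vector_field M A Y \<Longrightarrow> smooth_map A (push Y)"
  unfolding push_def[abs_def] by (rule smooth_map_differential[OF smooth_immersion])

lemma push_in_tangent_plane:
  "smooth_vector_field M A Y \<Longrightarrow> p \<in> topspace M \<Longrightarrow> push Y p \<in> tangent_plane A x p"
  unfolding push_def by (intro differential_in_tangent_plane smooth_vector_field_tangent)

lemma push_commutator:
  assumes "smooth_vector_field M A X" "smooth_vector_field M A Y" "c \<in> charts_at A p"
  shows "differential A (push Y) p (X p) - differential A (push X) p (Y p) =
    frechet_derivative (coord_rep c x) (at (snd c p)) (lie_bracket A X Y p c)"
  using differential_differential_commutator[OF smooth_immersion assms]
  unfolding push_def[abs_def] .

text \<open>The difference of the two flat derivatives is the image of the bracket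
  \<open>[X, Y]\<close> under the differential of \<open>x\<close>; it is tangent, so its normal
  part vanishes.\<close>

lemma normal_part_push_symmetric:
  assumes X: "smooth_vector_field M A X" and Y: "smooth_vector_field M A Y"
    and p: "p \<in> topspace M"
  shows "normal_part A x p (differential A (push Y) p (X p)) =
    normal_part A x p (differential A (push X) p (Y p))"
proof -
  obtain c where c: "c \<in> charts_at A p" using exists_chart[OF p] ..
  have "differential A (push Y) p (X p) - differential A (push X) p (Y p) \<in> tangent_plane A x p"
    unfolding push_commutator[OF X Y c] tangent_plane_eq_range[OF c] by simp
  from tangential_part_of_tangent[OF p this] show ?thesis
    by (simp add: tangential_part_diff[OF p] normal_part_def algebra_simps)
qed

text \<open>With \<open>X\<close> extending \<open>u\<close>, symmetry turns the normal part of the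
  derivative of \<open>Y\<close> along \<open>u\<close> into that of \<open>X\<close> along
  \<open>Y p\<close>. This depends on \<open>Y\<close> only through \<open>Y p\<close>, so the
  definite description is well defined.\<close>

lemma second_fundamental_form_eq:
  assumes p: "p \<in> topspace M" and u: "u \<in> tangent_space A p" and Y: "smooth_vector_field M A Y"
  shows "second_fundamental_form M A x p u (Y p) = normal_part A x p (differential A (push Y) p u)"
proof -
  obtain X where X: "smooth_vector_field M A X" "X p = u"
    using exists_smooth_extension[OF p u] by blast
  have *: "normal_part A x p (differential A (push Y) p u) =
      normal_part A x p (differential A (push Y') p u)"
    if "smooth_vector_field M A Y'" "Y' p = Y p" for Y'
    using normal_part_push_symmetric[OF X(1) Y p] normal_part_push_symmetric[OF X(1) that(1) p]
      X(2) that(2) by simp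
  have push: "(\<lambda>q. differential A x q (Z q)) = push Z" for Z
    by (simp add: fun_eq_iff push_def)
  show ?thesis
    unfolding second_fundamental_form_def push
  proof (rule the_equality)
    show "\<forall>Y'. smooth_vector_field M A Y' \<and> Y' p = Y p \<longrightarrow>
        normal_part A x p (differential A (push Y) p u) = normal_part A x p (differential A (push Y') p u)"
      using * by blast
  qed (use Y in blast)
qed

text \<open>The difference of the two sides is a tensor \<open>s(X, Y, Z)\<close> that is symmetric in \<open>X, Y\<close>
  (both connections are torsion-free) and antisymmetric in \<open>Y, Z\<close> (both are metric),
  hence zero.\<close>

lemma gauss_formula:
  assumes nabla: "levi_civita_connection M A g nabla"
    and p: "p \<in> topspace M" and u: "u \<in> tangent_space A p" and Y: "smooth_vector_field M A Y"
  shows "differential A x p (nabla p u Y) = tangential_part A x p (differential A (push Y) p u)"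
proof -
  have nabla_tangent: "nabla p u Y \<in> tangent_space A p"
    if "u \<in> tangent_space A p" "smooth_vector_field M A Y" for u Y
    using nabla that p unfolding levi_civita_connection_def affine_connection_def by blast
  define s where "s X Y Z =
    (differential A x p (nabla p (X p) Y) - differential A (push Y) p (X p)) \<bullet> push Z p" for X Y Z
  \<comment> \<open>Exchanging \<open>X\<close> and \<open>Y\<close> changes the covariant and the
    flat derivative by the same vector, the image of the bracket.\<close>
  have sym: "s X Y Z = s Y X Z"
    if X: "smooth_vector_field M A X" and Y: "smooth_vector_field M A Y" for X Y Z
  proof -
    obtain c where c: "c \<in> charts_at A p" using exists_chart[OF p] ..
    have Xp: "X p \<in> tangent_space A p" and Yp: "Y p \<in> tangent_space A p"
      using smooth_vector_field_tangent X Y p by blast+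
    have "(\<lambda>c. nabla p (X p) Y c - nabla p (Y p) X c) = lie_bracket A X Y p"
      using nabla X Y p unfolding levi_civita_connection_def by blast
    then have br: "lie_bracket A X Y p c = nabla p (X p) Y c - nabla p (Y p) X c" by metis
    have "linear (frechet_derivative (coord_rep c x) (at (snd c p)))"
      by (rule linear_frechet_derivative[OF smooth_map_chart_differentiable[OF smooth_immersion c]])
    from linear_diff[OF this]
    have "differential A (push Y) p (X p) - differential A (push X) p (Y p) =
        differential A x p (nabla p (X p) Y) - differential A x p (nabla p (Y p) X)"
      unfolding push_commutator[OF X Y c] br
      using differential_eq[OF c _ smooth_immersion] nabla_tangent X Y Xp Yp by simp
    then have "differential A x p (nabla p (X p) Y) - differential A (push Y) p (X p) =
        differential A x p (nabla p (Y p) X) - differential A (push X) p (Y p)"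
      by (simp add: algebra_simps)
    then show ?thesis by (simp add: s_def)
  qed
  \<comment> \<open>The derivative of \<open>g(Y, Z)\<close> along \<open>X\<close> is computed once
    by metric compatibility and once by the product rule for the ambient inner product, since
    \<open>g\<close> is the induced metric.\<close>
  have anti: "s X Y Z = - s X Z Y"
    if X: "smooth_vector_field M A X" and Y: "smooth_vector_field M A Y"
      and Z: "smooth_vector_field M A Z" for X Y Z
  proof -
    have t: "X p \<in> tangent_space A p" "Y p \<in> tangent_space A p" "Z p \<in> tangent_space A p"
      using smooth_vector_field_tangent X Y Z p by blast+
    have "differential A (\<lambda>q. g q (Y q) (Z q)) p (X p) =
        g p (nabla p (X p) Y) (Z p) + g p (Y p) (nabla p (X p) Z)"
      using nabla Y Z p t(1) unfolding levi_civita_connection_def by blast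
    moreover have "differential A (\<lambda>q. push Y q \<bullet> push Z q) p (X p) =
        differential A (\<lambda>q. g q (Y q) (Z q)) p (X p)"
    proof (rule differential_cong[OF smooth_map_inner[OF smooth_push[OF Y] smooth_push[OF Z]] _ p t(1)])
      fix q assume q: "q \<in> topspace M"
      show "push Y q \<bullet> push Z q = g q (Y q) (Z q)"
        using metric_eq[OF q] smooth_vector_field_tangent[OF Y q] smooth_vector_field_tangent[OF Z q]
        by (simp add: push_def)
    qed
    ultimately have "push Y p \<bullet> differential A (push Z) p (X p) + differential A (push Y) p (X p) \<bullet> push Z p =
        differential A x p (nabla p (X p) Y) \<bullet> push Z p + push Y p \<bullet> differential A x p (nabla p (X p) Z)"
      using differential_inner[OF smooth_push[OF Y] smooth_push[OF Z] p t(1)]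
        metric_eq[OF p] nabla_tangent t Y Z by (simp add: push_def)
    then show ?thesis by (simp add: s_def inner_diff_left inner_commute algebra_simps)
  qed
  \<comment> \<open>Alternating the two symmetries gives \<open>s X Y Z = s Y X Z = - s Y Z X = - s
    Z Y X = s Z X Y = s X Z Y = - s X Y Z\<close>.\<close>
  have s0: "s X Y Z = 0"
    if "smooth_vector_field M A X" "smooth_vector_field M A Y" "smooth_vector_field M A Z" for X Y Z
    using sym[OF that(1,2), of Z] anti[OF that(2,1,3)] sym[OF that(2,3), of X]
      anti[OF that(3,2,1)] sym[OF that(3,1), of Y] anti[OF that] by linarith
  \<comment> \<open>The symmetries of \<open>s\<close> concern fields, so \<open>u\<close>, and
    below every tangent test vector, is extended to a smooth field.\<close>
  obtain X where X: "smooth_vector_field M A X" "X p = u"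
    using exists_smooth_extension[OF p u] by blast
  show ?thesis
  proof (rule tangential_part_eqI[OF p, symmetric])
    show "differential A x p (nabla p u Y) \<in> tangent_plane A x p"
      by (intro differential_in_tangent_plane nabla_tangent u Y)
    fix t assume "t \<in> tangent_plane A x p"
    then obtain v where v: "v \<in> tangent_space A p" "t = differential A x p v"
      by (auto simp: tangent_plane_def)
    obtain Z where Z: "smooth_vector_field M A Z" "Z p = v"
      using exists_smooth_extension[OF p v(1)] by blast
    from s0[OF X(1) Y Z(1)] show "(differential A (push Y) p u - differential A x p (nabla p u Y)) \<bullet> t = 0"
      using X v Z by (simp add: s_def push_def inner_diff_left)
  qed
qed

section \<open>Covariant derivative of the tangential position field\<close>

lemma tangential_position_field_eq: "tangential_position_field A x = tangential_field x"
  by (simp add: fun_eq_iff tangential_position_field_def tangential_field_def)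

text \<open>Obtained by differentiating the orthogonality of \<open>x\<^sup>N\<close>, written
  \<open>?n\<close>, to an extension \<open>Y\<close> of \<open>v\<close>. Both directions of the
  equivalence rest on this identity.\<close>

lemma nabla_tangential_position_inner:
  assumes nabla: "levi_civita_connection M A g nabla"
    and p: "p \<in> topspace M" and u: "u \<in> tangent_space A p" and v: "v \<in> tangent_space A p"
  shows "(differential A x p (nabla p u (tangential_field x)) - differential A x p u) \<bullet> differential A x p v =
    x p \<bullet> second_fundamental_form M A x p u v"
proof -
  let ?Z = "tangential_field x" and ?n = "\<lambda>q. x q - push (tangential_field x) q"
  note Z = smooth_tangential_field[OF smooth_immersion]
  obtain Y where Y: "smooth_vector_field M A Y" "Y p = v"
    using exists_smooth_extension[OF p v] by blast
  have n: "?n q = normal_part A x q (x q)" if "q \<in> topspace M" for q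
    using tangential_field_props(2)[OF that] by (simp add: push_def normal_part_def)
  have ns: "smooth_map A ?n" by (intro smooth_map_diff smooth_immersion smooth_push Z)
  have vt: "differential A x p v \<in> tangent_plane A x p" by (rule differential_in_tangent_plane[OF v])
  let ?D = "differential A (push Y) p u"
  have "differential A (\<lambda>q. ?n q \<bullet> push Y q) p u = differential A (\<lambda>_. 0::real) p u"
    by (rule differential_cong[OF smooth_map_inner[OF ns smooth_push[OF Y(1)]] _ p u])
      (simp only: n normal_part_inner push_in_tangent_plane[OF Y(1)])
  also have "\<dots> = 0"
    by (simp add: differential_def coord_rep_def comp_def)
  finally have 0: "?n p \<bullet> ?D + differential A ?n p u \<bullet> differential A x p v = 0"
    using differential_inner[OF ns smooth_push[OF Y(1)] p u] Y(2) by (simp add: push_def)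
  have "differential A ?n p u = differential A x p u - differential A (push ?Z) p u"
    by (rule differential_diff[OF smooth_immersion smooth_push[OF Z] p u])
  \<comment> \<open>By the Gauss formula the covariant and the flat derivative of \<open>?Z\<close>
    differ by a normal vector, which the tangent vector \<open>differential A x p v\<close> does not
    see.\<close>
  then have 1: "differential A ?n p u \<bullet> differential A x p v =
      (differential A x p u - differential A x p (nabla p u ?Z)) \<bullet> differential A x p v"
    using tangential_part_props(2)[OF p vt, of "differential A (push ?Z) p u"]
    by (simp add: gauss_formula[OF nabla p u Z] inner_diff_left)
  \<comment> \<open>Two exchanges lead to \<open>?n p \<bullet> ?D\<close>: \<open>x\<close> and
    \<open>?n\<close> differ by a tangent vector, and \<open>?D\<close> and its normal part differ
    by one too.\<close>
  have "x p \<bullet> normal_part A x p ?D = ?n p \<bullet> normal_part A x p ?D"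
    using normal_part_inner[OF p push_in_tangent_plane[OF Z p], of ?D]
    by (simp only: inner_diff_left inner_commute[of "push ?Z p" "normal_part A x p ?D"] diff_zero)
  also have "\<dots> = ?n p \<bullet> ?D"
    using normal_part_inner[OF p tangential_part_props(1)[OF p], of "x p" ?D]
    by (simp add: n[OF p] normal_part_def[of A x p ?D] inner_diff_right)
  finally have 2: "x p \<bullet> second_fundamental_form M A x p u v = ?n p \<bullet> ?D"
    using second_fundamental_form_eq[OF p u Y(1)] Y(2) by simp
  show ?thesis using 0 1 2 by (simp add: inner_diff_left)
qed

lemma nabla_tangential_position_eq_iff:
  assumes nabla: "levi_civita_connection M A g nabla"
    and p: "p \<in> topspace M" and u: "u \<in> tangent_space A p"
  shows "nabla p u (tangential_field x) = u \<longleftrightarrow>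
    (\<forall>v\<in>tangent_space A p. x p \<bullet> second_fundamental_form M A x p u v = 0)"
proof
  assume "nabla p u (tangential_field x) = u"
  then show "\<forall>v\<in>tangent_space A p. x p \<bullet> second_fundamental_form M A x p u v = 0"
    using nabla_tangential_position_inner[OF nabla p u] by simp
next
  let ?w = "nabla p u (tangential_field x)"
  assume h: "\<forall>v\<in>tangent_space A p. x p \<bullet> second_fundamental_form M A x p u v = 0"
  have w: "?w \<in> tangent_space A p"
    using nabla smooth_tangential_field[OF smooth_immersion] p u
    unfolding levi_civita_connection_def affine_connection_def by blast
  let ?d = "differential A x p ?w - differential A x p u"
  \<comment> \<open>Testing with \<open>v = ?w\<close> and \<open>v = u\<close> suffices, because
    \<open>?d\<close> is the difference of their images and is thus orthogonal to itself.\<close>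
  have "?d \<bullet> differential A x p ?w = 0" "?d \<bullet> differential A x p u = 0"
    using nabla_tangential_position_inner[OF nabla p u] h u w by auto
  then have "?d \<bullet> ?d = 0" by (simp add: inner_diff_right)
  then show "?w = u" using inj_on_differential[OF p] w u by (auto dest: inj_onD)
qed

text \<open>The vectors orthogonal to \<open>x p\<close> form a subspace, so orthogonality to the
  span can be checked on the generators.\<close>

lemma rectifying_iff:
  "rectifying M A x \<longleftrightarrow> (\<forall>p\<in>topspace M. \<forall>u\<in>tangent_space A p. \<forall>v\<in>tangent_space A p.
    x p \<bullet> second_fundamental_form M A x p u v = 0)" (is "_ \<longleftrightarrow> ?R")
proof
  assume "rectifying M A x"
  then show ?R unfolding rectifying_def first_normal_space_def by (blast intro: span_base)
next
  assume R: ?R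
  have "x p \<bullet> w = 0" if p: "p \<in> topspace M" and w: "w \<in> first_normal_space M A x p" for p w
    using w unfolding first_normal_space_def
    by (induction rule: span_induct) (use R p in \<open>auto simp: subspace_hyperplane\<close>)
  then show "rectifying M A x" unfolding rectifying_def by blast
qed

text \<open>The differential of \<open>x\<close> is injective and sends the zero tangent vector to
  \<open>0\<close>, so passing between the field and its image in the ambient space preserves
  vanishing.\<close>

lemma tangential_field_eq_0_iff:
  assumes p: "p \<in> topspace M"
  shows "tangential_field W p = (\<lambda>_. 0) \<longleftrightarrow> tangential_part A x p (W p) = 0"
proof -
  note t = tangential_field_props[OF p, of W]
  obtain c where c: "c \<in> charts_at A p" using exists_chart[OF p] ..
  have lin: "linear (frechet_derivative (coord_rep c x) (at (snd c p)))"
    by (rule linear_frechet_derivative[OF smooth_map_chart_differentiable[OF smooth_immersion c]])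
  \<comment> \<open>The zero vector is obtained as the multiple by \<open>0\<close> of a tangent
    vector already at hand.\<close>
  have z: "(\<lambda>_. 0) \<in> tangent_space A p" using tangent_space_scaleR[OF t(1), of 0] by simp
  have d0: "differential A x p (\<lambda>_. 0) = 0"
    using differential_eq[OF c z smooth_immersion] linear_0[OF lin] by simp
  show ?thesis
    using d0 t z inj_on_differential[OF p] by (metis inj_onD)
qed

end

theorem theorem4p1:
  fixes M :: "'a topology"
    and A :: "('a, real ^ 'n) chart set"
    and g :: "('a, real ^ 'n) metric"
    and nabla :: "('a, real ^ 'n) connection"
    and x :: "'a \<Rightarrow> real ^ 'm"
  assumes "euclidean_submanifold M A g x"
    and "levi_civita_connection M A g nabla"
    and "\<forall>p\<in>topspace M. normal_part A x p (x p) \<noteq> 0"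
  shows "proper_rectifying M A x \<longleftrightarrow>
         concurrent_vector_field M A nabla (tangential_position_field A x)"
proof -
  interpret euclidean_immersion M A g x by unfold_locales (rule assms(1))
  \<comment> \<open>The first inequality is the hypothesis \<open>x\<^sup>N \<noteq> 0\<close>. The
    second says \<open>x\<^sup>T \<noteq> 0\<close>, which is the non-triviality demanded of a
    concurrent field.\<close>
  have "(x p \<noteq> tangential_part A x p (x p) \<and> x p \<noteq> normal_part A x p (x p)) \<longleftrightarrow>
      tangential_field x p \<noteq> (\<lambda>_. 0)" if "p \<in> topspace M" for p
    using assms(3) that tangential_field_eq_0_iff[OF that, of x] by (auto simp: normal_part_def)
  moreover have "rectifying M A x \<longleftrightarrow>
      (\<forall>p\<in>topspace M. \<forall>u\<in>tangent_space A p. nabla p u (tangential_field x) = u)"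
    using nabla_tangential_position_eq_iff[OF assms(2)] by (simp add: rectifying_iff)
  ultimately show ?thesis
    unfolding proper_rectifying_def concurrent_vector_field_def tangential_position_field_eq
    using smooth_tangential_field[OF smooth_immersion] by blast
qed

end
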